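(* Assume $H>K$, and let $V$ be the random variable such that, $\mathbb P$-almost surely, $$V_n^{(1/K)}(Y,t)\longrightarrow Vt\qquad\text{as } n\to\infty,\ \text{for all } t\in[0,1].$$ Then $V\in L^q$ for every $1\le q<\infty$, and the law of $V$ is absolutely continuous with respect to Lebesgue measure on $\mathbb R$. In particular, $V$ is not almost surely constant.
   Context: Let $(\Omega,\mathcal F,\mathbb P)$ be a probability space, $H\in(0,1)$, and let $W_H=\{W_H(t):0\le t\le 1\}$ be a continuous fractional Brownian motion with Hurst parameter $H$, i.e. a continuous centered Gaussian process with $\mathbb E[W_H(s)W_H(t)]=\frac12(s^{2H}+t^{2H}-|t-s|^{2H})$. Let $\kappa:[0,1]\to[0,1]$ be a deterministic function with $\kappa(0)=0$, $\kappa(1)=1$, Hölder continuous with some exponent $\tau\in(H,1]$, and put $B_H(u):=W_H(u)-\kappa(u)W_H(1)$, $0\le u\le1$. Let $\alpha\in(0,1)$ and $b\in\{2,3,\dots\}$. The fractional Wiener--Weierstrass bridge with parameters $\alpha,b,H$ is $$Y(t):=\sum_{n=0}^\infty\alpha^nB_H(\{b^nt\}),\qquad 0\le t\le1,$$ where $\{x\}$ denotes the fractional part of $x\ge0$. Put $K:=\min\{1,-\log_b\alpha\}$. For a continuous function $f:[0,1]\to\mathbb R$ and $q>0$, write $V_n^{(q)}(f,t):=\sum_{k=0}^{\lfloor tb^n\rfloor-1}|f((k+1)b^{-n})-f(kb^{-n})|^q$, $0\le t\le 1$. It is known (from earlier work) that if $H>K$, there exists a finite and strictly positive random variable $V$ such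 that, $\mathbb P$-a.s., $V_n^{(1/K)}(Y,t)\to Vt$ for all $t\in[0,1]$; $V$ is called the limiting random coefficient. *)

theory Defs
  imports "HOL-Probability.Probability"
begin

text \<open>The second disjunct covers the degenerate normal laws, which have no density.\<close>

definition gaussian_rv :: "'a measure \<Rightarrow> ('a \<Rightarrow> real) \<Rightarrow> bool" where
  "gaussian_rv M X \<longleftrightarrow> X \<in> borel_measurable M \<and>
     (\<exists>\<mu> \<sigma>. (\<sigma> > 0 \<and> distributed M lborel X (\<lambda>x. ennreal (normal_density \<mu> \<sigma> x)))
          \<or> (AE \<omega> in M. X \<omega> = \<mu>))"

definition gaussian_process :: "'a measure \<Rightarrow> 'i set \<Rightarrow> ('i \<Rightarrow> 'a \<Rightarrow> real) \<Rightarrow> bool" where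
  "gaussian_process M T X \<longleftrightarrow>
     (\<forall>J c. finite J \<and> J \<subseteq> T \<longrightarrow> gaussian_rv M (\<lambda>\<omega>. \<Sum>t\<in>J. c t * X t \<omega>))"

text \<open>Only the values \<open>W t\<close> with \<open>0 \<le> t \<le> 1\<close> are constrained.\<close>

definition continuous_fBm :: "'a measure \<Rightarrow> real \<Rightarrow> (real \<Rightarrow> 'a \<Rightarrow> real) \<Rightarrow> bool" where
  "continuous_fBm M H W \<longleftrightarrow>
     gaussian_process M {0..1} W \<and>
     (\<forall>\<omega>\<in>space M. continuous_on {0..1} (\<lambda>t. W t \<omega>)) \<and>
     (\<forall>t\<in>{0..1}. (\<integral>\<omega>. W t \<omega> \<partial>M) = 0) \<and>
     (\<forall>s\<in>{0..1}. \<forall>t\<in>{0..1}. (\<integral>\<omega>. W s \<omega> * W t \<omega> \<partial>M) =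
        (1/2) * (s powr (2 * H) + t powr (2 * H) - \<bar>t - s\<bar> powr (2 * H)))"

definition holder_continuous_on :: "real set \<Rightarrow> real \<Rightarrow> (real \<Rightarrow> real) \<Rightarrow> bool" where
  "holder_continuous_on S \<tau> f \<longleftrightarrow>
     (\<exists>C. \<forall>s\<in>S. \<forall>t\<in>S. \<bar>f s - f t\<bar> \<le> C * \<bar>s - t\<bar> powr \<tau>)"

definition fractional_bridge ::
  "(real \<Rightarrow> real) \<Rightarrow> (real \<Rightarrow> 'a \<Rightarrow> real) \<Rightarrow> real \<Rightarrow> 'a \<Rightarrow> real" where
  "fractional_bridge \<kappa> W u \<omega> = W u \<omega> - \<kappa> u * W 1 \<omega>"

definition wiener_weierstrass_bridge ::
  "real \<Rightarrow> nat \<Rightarrow> (real \<Rightarrow> real) \<Rightarrow> (real \<Rightarrow> 'a \<Rightarrow> real) \<Rightarrow> real \<Rightarrow> 'a \<Rightarrow> real" where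
  "wiener_weierstrass_bridge \<alpha> b \<kappa> W t \<omega> =
     (\<Sum>n. \<alpha> ^ n * fractional_bridge \<kappa> W (frac (real b ^ n * t)) \<omega>)"

definition roughness_exponent :: "real \<Rightarrow> nat \<Rightarrow> real" where
  "roughness_exponent \<alpha> b = min 1 (- log (real b) \<alpha>)"

definition qth_variation :: "nat \<Rightarrow> real \<Rightarrow> nat \<Rightarrow> (real \<Rightarrow> real) \<Rightarrow> real \<Rightarrow> real" where
  "qth_variation b q n f t =
     (\<Sum>k<nat \<lfloor>t * real b ^ n\<rfloor>.
        \<bar>f ((real k + 1) / real b ^ n) - f (real k / real b ^ n)\<bar> powr q)"

end

theory Submission
  imports Defs
begin

text \<open>
  Writing \<open>q = 1 / K\<close>, so that \<open>\<alpha> powr q = 1 / b\<close>, the variation \<open>V\<^sub>n(1)\<close> is the mean over \<open>k < b^n\<close>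
  of \<open>\<bar>L n k W\<bar> powr q\<close>, where \<open>L n k\<close> is a linear functional (\<open>scaled_incr\<close> below) whose terms
  decay geometrically because \<open>H > K\<close>. Jensen's inequality bounds all moments of these means
  uniformly in \<open>n\<close>, and Fatou's lemma passes the bounds to \<open>V\<close>.

  For absolute continuity, decompose \<open>W = W' + \<phi> X\<close> with \<open>X\<close> standard normal and independent of \<open>W'\<close>.
  For fixed \<open>W'\<close> the means are convex in \<open>X\<close>, and their limit is strictly convex as soon as
  \<open>L n k \<phi>\<close> stays away from \<open>0\<close> for a positive fraction of the \<open>k\<close>; a strictly convex function
  pulls null sets back to null sets. Taking for \<open>X\<close> the normalised value \<open>W(t\<^sub>0)\<close>, self-similarity
  shows that some \<open>t\<^sub>0\<close> makes \<open>\<phi>\<close> nondegenerate in this sense.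
\<close>

section \<open>Laws of processes and characteristic functions\<close>

text \<open>\<open>V\<close> is known only as an almost sure limit: there is no formula for it, and
  a strict inequality may be lost in the limit. Convexity along one Gaussian direction survives, but
  strictness does so only if the convexity gap is bounded below uniformly in \<open>n\<close>. That
  is why a positive fraction of nondegenerate indices is required. The decay rate is
  \<open>b powr (- H) / \<alpha>\<close>: an increment of \<open>W\<close> over a cell of length
  \<open>1 / b ^ j\<close> has size of order \<open>b powr (- H * j)\<close> and enters
  \<open>L n k\<close> with the factor \<open>1 / \<alpha> ^ j\<close>. Nondegeneracy is delicate
  because \<kappa> is almost arbitrary and its term might cancel a given direction; hence
  \<open>t\<^sub>0\<close> is obtained by contradiction and not named. Independence is never
  established on \<open>M\<close> itself. Instead, the process rebuilt with a fresh normal variable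
  on a product space is shown to have the law of \<open>W\<close>. Each mean depends on finitely
  many values of the path, so convergence and the position of the limit are events of the product
  sigma-algebra. They transfer between the two spaces, and Fubini reduces the claim to one real
  variable.\<close>

lemma weighted_law_eqI:
  fixes X :: "'a \<Rightarrow> real" and Y :: "'b \<Rightarrow> real"
  assumes "prob_space M" "prob_space N"
    and [measurable]: "X \<in> borel_measurable M" "Y \<in> borel_measurable N"
      "f \<in> borel_measurable M" "g \<in> borel_measurable N"
    and f: "\<And>x. 0 \<le> f x" "\<And>x. f x \<le> C" and g: "\<And>x. 0 \<le> g x" "\<And>x. g x \<le> C"
    and eq: "\<And>t. (CLINT x|M. of_real (f x) * iexp (t * X x)) = (CLINT x|N. of_real (g x) * iexp (t * Y x))"
    and [measurable]: "B \<in> sets borel"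
  shows "(LINT x|M. f x * indicator B (X x)) = (LINT x|N. g x * indicator B (Y x))"
proof -
  interpret M: prob_space M by fact
  interpret N: prob_space N by fact
  have intf: "integrable M f"
    by (rule M.integrable_const_bound[where B=C]) (use f in auto)
  have intg: "integrable N g"
    by (rule N.integrable_const_bound[where B=C]) (use g in auto)
  define m where "m = (LINT x|M. f x)"
  have m2: "m = (LINT x|N. g x)"
  proof -
    have "complex_of_real (LINT x|M. f x) = of_real (LINT x|N. g x)"
      using eq[of 0] by simp
    then show ?thesis unfolding m_def using of_real_eq_iff by blast
  qed
  have m0: "m \<ge> 0" unfolding m_def using f by (simp add: integral_nonneg)
  show ?thesis
  proof (cases "m = 0")
    case True
    have "AE x in M. f x = 0"
      using integral_nonneg_eq_0_iff_AE[OF intf] f True m_def by auto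
    then have 1: "(LINT x|M. f x * indicator B (X x)) = (LINT x|M. 0)"
      by (intro integral_cong_AE) auto
    have "AE x in N. g x = 0"
      using integral_nonneg_eq_0_iff_AE[OF intg] g True m2 by auto
    then have 2: "(LINT x|N. g x * indicator B (Y x)) = (LINT x|N. 0)"
      by (intro integral_cong_AE) auto
    show ?thesis using 1 2 by simp
  next
    case False
    then have mp: "m > 0" using m0 by simp
    \<comment> \<open>The transforms at \<open>t = 0\<close> give both weights the same total mass
      \<open>m\<close>. Dividing by it makes them probability densities, to which Levy's theorem
      applies; this is why \<open>m = 0\<close> is treated apart.\<close>
    define P where "P = distr (density M (\<lambda>x. ennreal (f x / m))) borel X"
    define Q where "Q = distr (density N (\<lambda>x. ennreal (g x / m))) borel Y"
    have "prob_space (density M (\<lambda>x. ennreal (f x / m)))"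
    proof (rule prob_spaceI)
      have "(\<integral>\<^sup>+x. ennreal (f x / m) \<partial>M) = ennreal (LINT x|M. f x / m)"
        by (rule nn_integral_eq_integral) (use intf f mp in auto)
      also have "\<dots> = 1" using mp by (simp add: m_def)
      finally show "emeasure (density M (\<lambda>x. ennreal (f x / m))) (space (density M (\<lambda>x. ennreal (f x / m)))) = 1"
        by (subst emeasure_density) (auto intro!: nn_integral_cong simp: indicator_def cong: nn_integral_cong)
    qed
    then interpret P: prob_space "density M (\<lambda>x. ennreal (f x / m))" .
    have "prob_space (density N (\<lambda>x. ennreal (g x / m)))"
    proof (rule prob_spaceI)
      have "(\<integral>\<^sup>+x. ennreal (g x / m) \<partial>N) = ennreal (LINT x|N. g x / m)"
        by (rule nn_integral_eq_integral) (use intg g mp in auto)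
      also have "\<dots> = 1" using mp by (simp add: m2)
      finally show "emeasure (density N (\<lambda>x. ennreal (g x / m))) (space (density N (\<lambda>x. ennreal (g x / m)))) = 1"
        by (subst emeasure_density) (auto intro!: nn_integral_cong simp: indicator_def cong: nn_integral_cong)
    qed
    then interpret Q: prob_space "density N (\<lambda>x. ennreal (g x / m))" .
    have P: "real_distribution P" unfolding P_def
      by (rule P.real_distribution_distr) simp
    have Q: "real_distribution Q" unfolding Q_def
      by (rule Q.real_distribution_distr) simp
    have "char P t = char Q t" for t
    proof -
      have "char P t = (CLINT x|M. (f x / m) *\<^sub>R iexp (t * X x))"
        unfolding P_def char_def
        by (subst integral_distr, simp, simp, subst integral_density) (use f mp in auto)
      also have "\<dots> = (CLINT x|M. (of_real (f x) * iexp (t * X x)) / of_real m)"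
        by (intro Bochner_Integration.integral_cong) (auto simp: scaleR_conv_of_real)
      also have "\<dots> = (CLINT x|N. (of_real (g x) * iexp (t * Y x)) / of_real m)"
        using eq[of t] by simp
      also have "\<dots> = (CLINT x|N. (g x / m) *\<^sub>R iexp (t * Y x))"
        by (intro Bochner_Integration.integral_cong) (auto simp: scaleR_conv_of_real)
      also have "\<dots> = char Q t"
        unfolding Q_def char_def
        by (subst integral_distr, simp, simp, subst integral_density) (use g mp in auto)
      finally show ?thesis .
    qed
    then have PQ: "P = Q" using Levy_uniqueness[OF P Q] by blast
    have 1: "(LINT x|P. indicator B x) = (LINT x|M. f x * indicator B (X x)) / m"
      unfolding P_def
      by (subst integral_distr, simp, simp, subst integral_density) (use f mp in auto)
    have 2: "(LINT x|Q. indicator B x) = (LINT x|N. g x * indicator B (Y x)) / m"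
      unfolding Q_def
      by (subst integral_distr, simp, simp, subst integral_density) (use g mp in auto)
    have "(LINT x|M. f x * indicator B (X x)) / m = (LINT x|N. g x * indicator B (Y x)) / m"
      using 1 2 PQ by simp
    then show ?thesis using mp by simp
  qed
qed

lemma integrable_iexp_bounded:
  fixes f h :: "'a \<Rightarrow> real"
  assumes "prob_space M" and [measurable]: "f \<in> borel_measurable M" "h \<in> borel_measurable M"
    and "\<And>x. \<bar>f x\<bar> \<le> C"
  shows "integrable M (\<lambda>x. of_real (f x) * iexp (h x))"
proof -
  interpret prob_space M by fact
  show ?thesis
    by (rule integrable_const_bound[where B=C]) (use assms in \<open>auto simp: norm_mult\<close>)
qed

text \<open>Levy's uniqueness theorem needs nonnegative weights, hence the detour from \<open>e\<^sup>i\<^sup>u\<close> to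
  \<open>1 + cos (u + \<theta>)\<close>.\<close>

lemma weighted_trig_law_eqI:
  fixes X :: "'a \<Rightarrow> real" and Y :: "'b \<Rightarrow> real"
  assumes M: "prob_space M" and N: "prob_space N"
    and [measurable]: "X \<in> borel_measurable M" "Y \<in> borel_measurable N"
      "f \<in> borel_measurable M" "g \<in> borel_measurable N"
      "u \<in> borel_measurable M" "v \<in> borel_measurable N"
    and f: "\<And>x. 0 \<le> f x" "\<And>x. f x \<le> 1" and g: "\<And>x. 0 \<le> g x" "\<And>x. g x \<le> 1"
    and eq: "\<And>s t. (CLINT x|M. of_real (f x) * iexp (s * u x + t * X x))
      = (CLINT x|N. of_real (g x) * iexp (s * v x + t * Y x))"
    and [measurable]: "B \<in> sets borel"
  shows "(CLINT x|M. of_real (f x * indicator B (X x)) * iexp (u x))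
    = (CLINT x|N. of_real (g x * indicator B (Y x)) * iexp (v x))"
proof -
  interpret M: prob_space M by fact
  interpret N: prob_space N by fact
  have plain: "(LINT x|M. f x * indicator B (X x)) = (LINT x|N. g x * indicator B (Y x))"
    by (rule weighted_law_eqI[where C=1]) (use assms eq[of 0] in auto)
  have fa: "\<bar>f x\<bar> \<le> 1" for x using f[of x] by simp
  have ga: "\<bar>g x\<bar> \<le> 1" for x using g[of x] by simp
  have intM: "integrable M (\<lambda>x. of_real (f x) * iexp (h x))" if "h \<in> borel_measurable M" for h
    by (rule integrable_iexp_bounded[OF M _ that fa]) simp
  have intN: "integrable N (\<lambda>x. of_real (g x) * iexp (h x))" if "h \<in> borel_measurable N" for h
    by (rule integrable_iexp_bounded[OF N _ that ga]) simp
  have trig: "(LINT x|M. (f x * (1 + cos (u x + \<theta>))) * indicator B (X x))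
      = (LINT x|N. (g x * (1 + cos (v x + \<theta>))) * indicator B (Y x))" for \<theta>
  proof (rule weighted_law_eqI[OF M N, where C=2])
    show "f x * (1 + cos (u x + \<theta>)) \<le> 2" for x
      using mult_mono[of "f x" 1 "1 + cos (u x + \<theta>)" 2] f[of x] cos_ge_minus_one[of "u x + \<theta>"] by simp
    show "g x * (1 + cos (v x + \<theta>)) \<le> 2" for x
      using mult_mono[of "g x" 1 "1 + cos (v x + \<theta>)" 2] g[of x] cos_ge_minus_one[of "v x + \<theta>"] by simp
    show "0 \<le> f x * (1 + cos (u x + \<theta>))" for x
      using f[of x] cos_ge_minus_one[of "u x + \<theta>"] by (intro mult_nonneg_nonneg; linarith)
    show "0 \<le> g x * (1 + cos (v x + \<theta>))" for x
      using g[of x] cos_ge_minus_one[of "v x + \<theta>"] by (intro mult_nonneg_nonneg; linarith)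
    fix t
    \<comment> \<open>The new weight splits into three exponentials, with frequencies 0, 1 and -1 in
      front of \<open>u\<close>, each of which is an instance of \<open>eq\<close>.\<close>
    have expand: "of_real (p * (1 + cos (a + \<theta>))) * iexp c =
       of_real p * iexp (0 * a + c) + (iexp \<theta> / 2) * (of_real p * iexp (1 * a + c))
        + (iexp (-\<theta>) / 2) * (of_real p * iexp ((-1) * a + c))" for p a c :: real
    proof -
      have "complex_of_real (cos (a + \<theta>)) = (iexp (a + \<theta>) + iexp (- (a + \<theta>))) / 2"
        by (simp add: cos_of_real[symmetric] cos_exp_eq del: minus_add_distrib)
      also have "\<dots> = (iexp \<theta> * iexp a + iexp (-\<theta>) * iexp (-a)) / 2"
        unfolding exp_add[symmetric]
        by (intro arg_cong2[where f="\<lambda>x y. (exp x + exp y) / 2"]) (simp_all add: algebra_simps)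
      finally have "complex_of_real (cos (a + \<theta>)) = (iexp \<theta> * iexp a + iexp (-\<theta>) * iexp (-a)) / 2" .
      then show ?thesis by (simp add: exp_add[symmetric] algebra_simps add_divide_distrib)
    qed
    show "(CLINT x|M. of_real (f x * (1 + cos (u x + \<theta>))) * iexp (t * X x))
      = (CLINT x|N. of_real (g x * (1 + cos (v x + \<theta>))) * iexp (t * Y x))"
      unfolding expand
      using intM intN eq by (simp only: Bochner_Integration.integral_add integral_mult_right_zero integrable_mult_right Bochner_Integration.integrable_add borel_measurable_add borel_measurable_times borel_measurable_const assms(3-8) simp_thms)
  qed (use f g in \<open>auto\<close>)
  have part: "(LINT x|M. (f x * indicator B (X x)) * cos (u x + \<theta>))
      = (LINT x|N. (g x * indicator B (Y x)) * cos (v x + \<theta>))" for \<theta>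
  proof -
    have iM: "integrable M (\<lambda>x. f x * indicator B (X x))" "integrable M (\<lambda>x. (f x * indicator B (X x)) * cos (u x + \<theta>))"
      by (auto intro!: M.integrable_const_bound[where B=1] simp: abs_mult fa mult_le_one split: split_indicator)
    have iN: "integrable N (\<lambda>x. g x * indicator B (Y x))" "integrable N (\<lambda>x. (g x * indicator B (Y x)) * cos (v x + \<theta>))"
      by (auto intro!: N.integrable_const_bound[where B=1] simp: abs_mult ga mult_le_one split: split_indicator)
    have "(LINT x|M. (f x * (1 + cos (u x + \<theta>))) * indicator B (X x)) =
       (LINT x|M. f x * indicator B (X x)) + (LINT x|M. (f x * indicator B (X x)) * cos (u x + \<theta>))"
      by (subst Bochner_Integration.integral_add[OF iM, symmetric]) (simp add: algebra_simps)
    moreover have "(LINT x|N. (g x * (1 + cos (v x + \<theta>))) * indicator B (Y x)) =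
       (LINT x|N. g x * indicator B (Y x)) + (LINT x|N. (g x * indicator B (Y x)) * cos (v x + \<theta>))"
      by (subst Bochner_Integration.integral_add[OF iN, symmetric]) (simp add: algebra_simps)
    ultimately show ?thesis using trig[of \<theta>] plain by simp
  qed
  \<comment> \<open>The shifts \<theta> = 0 and \<theta> = - pi/2 turn \<open>part\<close> into the
    real and the imaginary part.\<close>
  have split: "of_real p * iexp a = of_real (p * cos (a + 0)) + \<i> * of_real (p * cos (a + - (pi/2)))" for p a :: real
    by (simp add: exp_Euler cos_of_real sin_of_real algebra_simps cos_diff)
  have iM: "integrable M (\<lambda>x. complex_of_real ((f x * indicator B (X x)) * cos (u x + \<theta>)))" for \<theta>
    by (auto intro!: M.integrable_const_bound[where B=1] simp: abs_mult norm_mult fa mult_le_one split: split_indicator)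
  have iN: "integrable N (\<lambda>x. complex_of_real ((g x * indicator B (Y x)) * cos (v x + \<theta>)))" for \<theta>
    by (auto intro!: N.integrable_const_bound[where B=1] simp: abs_mult norm_mult ga mult_le_one split: split_indicator)
  show ?thesis
    unfolding split
    using iM iN part
    by (simp only: Bochner_Integration.integral_add integral_mult_right_zero integrable_mult_right integral_complex_of_real)
qed

text \<open>A one-dimensional uniqueness theorem suffices: the coordinates are converted one after
  the other from exponentials into indicators. Once all are converted, the cylinder probabilities
  agree, and these determine a measure on the product space.\<close>

lemma process_law_eqI:
  fixes X :: "'i \<Rightarrow> 'a \<Rightarrow> real" and Y :: "'i \<Rightarrow> 'b \<Rightarrow> real"
  assumes M: "prob_space M" and N: "prob_space N"
    and X: "\<And>i. i \<in> I \<Longrightarrow> X i \<in> borel_measurable M" and Y: "\<And>i. i \<in> I \<Longrightarrow> Y i \<in> borel_measurable N"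
    and eq: "\<And>J c. finite J \<Longrightarrow> J \<subseteq> I \<Longrightarrow>
      (CLINT x|M. iexp (\<Sum>i\<in>J. c i * X i x)) = (CLINT x|N. iexp (\<Sum>i\<in>J. c i * Y i x))"
  shows "distr M (PiM I (\<lambda>_. borel)) (\<lambda>x. \<lambda>i\<in>I. X i x) = distr N (PiM I (\<lambda>_. borel)) (\<lambda>x. \<lambda>i\<in>I. Y i x)"
proof -
  interpret M: prob_space M by fact
  interpret N: prob_space N by fact
  \<comment> \<open>The exponential keeps all coordinates of \<open>T\<close> and arbitrary
    coefficients. When coordinate \<open>j\<close> is converted, the extra frequency
    \<open>t\<close> in front of \<open>X j\<close> is absorbed into \<open>c\<close> (fact
    \<open>lin\<close>), so the induction hypothesis applies.\<close>
  have rect: "(CLINT x|M. of_real (\<Prod>j\<in>J. indicator (A j) (X j x)) * iexp (\<Sum>i\<in>T. c i * X i x))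
     = (CLINT x|N. of_real (\<Prod>j\<in>J. indicator (A j) (Y j x)) * iexp (\<Sum>i\<in>T. c i * Y i x))"
    if T: "finite T" "T \<subseteq> I" and J: "J \<subseteq> T" and A: "\<And>j. j \<in> T \<Longrightarrow> A j \<in> sets borel" for J T A c
  proof -
    have "finite J" using T J finite_subset by blast
    then show ?thesis using J
    proof (induction J arbitrary: c rule: finite_induct)
      case empty
      then show ?case using eq[OF T] by simp
    next
      case (insert j J)
      have [measurable]: "X i \<in> borel_measurable M" "Y i \<in> borel_measurable N" if "i \<in> T" for i
        using X Y T that by auto
      have jT: "j \<in> T" "J \<subseteq> T" using insert by auto
      have [measurable]: "X j \<in> borel_measurable M" "Y j \<in> borel_measurable N" using X Y T jT by auto
      have [measurable]: "(\<lambda>x. \<Sum>i\<in>T. c i * X i x) \<in> borel_measurable M" "(\<lambda>x. \<Sum>i\<in>T. c i * Y i x) \<in> borel_measurable N" for c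
        by measurable
      have [measurable]: "(\<lambda>x. (\<Prod>j\<in>J. indicator (A j) (X j x))::real) \<in> borel_measurable M" "(\<lambda>x. (\<Prod>j\<in>J. indicator (A j) (Y j x))::real) \<in> borel_measurable N"
      proof -
        have "(\<lambda>x. indicator (A j) (X j x)::real) \<in> borel_measurable M" "(\<lambda>x. indicator (A j) (Y j x)::real) \<in> borel_measurable N" if "j \<in> J" for j
        proof -
          have jj: "j \<in> T" using that jT by auto
          have [measurable]: "X j \<in> borel_measurable M" "Y j \<in> borel_measurable N" "A j \<in> sets borel" using X Y T A jj by auto
          show "(\<lambda>x. indicator (A j) (X j x)::real) \<in> borel_measurable M" "(\<lambda>x. indicator (A j) (Y j x)::real) \<in> borel_measurable N"
            by measurable
        qed
        then show "(\<lambda>x. (\<Prod>j\<in>J. indicator (A j) (X j x))::real) \<in> borel_measurable M" "(\<lambda>x. (\<Prod>j\<in>J. indicator (A j) (Y j x))::real) \<in> borel_measurable N"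
          by (auto intro!: borel_measurable_prod)
      qed
      have lin: "s * (\<Sum>i\<in>T. c i * Z i) + t * Z j = (\<Sum>i\<in>T. (s * c i + (if i = j then t else 0)) * Z i)" for s t and Z :: "'i \<Rightarrow> real"
        using T jT by (simp add: sum.distrib distrib_right sum_distrib_left mult.assoc if_distrib[where f="\<lambda>x. x * _"] sum.delta' cong: if_cong)
      have "(CLINT x|M. of_real ((\<Prod>j\<in>J. indicator (A j) (X j x)) * indicator (A j) (X j x)) * iexp (\<Sum>i\<in>T. c i * X i x))
         = (CLINT x|N. of_real ((\<Prod>j\<in>J. indicator (A j) (Y j x)) * indicator (A j) (Y j x)) * iexp (\<Sum>i\<in>T. c i * Y i x))"
      proof (rule weighted_trig_law_eqI[OF M N])
        fix s t
        show "(CLINT x|M. of_real (\<Prod>j\<in>J. indicator (A j) (X j x)) * iexp (s * (\<Sum>i\<in>T. c i * X i x) + t * X j x))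
          = (CLINT x|N. of_real (\<Prod>j\<in>J. indicator (A j) (Y j x)) * iexp (s * (\<Sum>i\<in>T. c i * Y i x) + t * Y j x))"
          unfolding lin[of s "\<lambda>i. X i x" t for x] lin[of s "\<lambda>i. Y i x" t for x]
            by (rule insert.IH[OF jT(2)])
      qed (use A jT in \<open>auto intro!: prod_nonneg prod_le_1\<close>)
      then show ?case using insert.hyps by (simp add: mult.commute)
    qed
  qed
  have mX: "(\<lambda>x. \<lambda>i\<in>I. X i x) \<in> measurable M (PiM I (\<lambda>_. borel))"
    using X by (rule measurable_restrict)
  have mY: "(\<lambda>x. \<lambda>i\<in>I. Y i x) \<in> measurable N (PiM I (\<lambda>_. borel))"
    using Y by (rule measurable_restrict)
  interpret P: prob_space "distr M (PiM I (\<lambda>_. borel)) (\<lambda>x. \<lambda>i\<in>I. X i x)"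
    by (rule M.prob_space_distr[OF mX])
  show ?thesis
  proof (rule measure_eqI_PiM_infinite)
    fix A :: "'i \<Rightarrow> real set" and J :: "'i set"
    assume J: "finite J" "J \<subseteq> I" and A: "\<And>i. i \<in> J \<Longrightarrow> A i \<in> sets borel"
    have emb: "prod_emb I (\<lambda>_. borel) J (Pi\<^sub>E J A) \<in> sets (PiM I (\<lambda>_. borel))"
      using J A by (intro sets_PiM_I) auto
    have meas: "measure M {x\<in>space M. \<forall>i\<in>J. X i x \<in> A i} = measure N {x\<in>space N. \<forall>i\<in>J. Y i x \<in> A i}"
    proof -
      have 1: "(\<Prod>j\<in>J. indicator (A j) (Z j)) = (indicator {x\<in>S. \<forall>i\<in>J. Z' i x \<in> A i} x :: real)" if "x \<in> S" "Z = (\<lambda>i. Z' i x)" for Z x S and Z' :: "'i \<Rightarrow> 'c \<Rightarrow> real"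
        using J(1) that by (induction J rule: finite_induct) (auto simp: indicator_def)
      \<comment> \<open>Coefficients 0 and \<open>T = J\<close>: no exponential is left, only the
        probability of a cylinder.\<close>
      have "(CLINT x|M. of_real (\<Prod>j\<in>J. indicator (A j) (X j x))) = (CLINT x|N. of_real (\<Prod>j\<in>J. indicator (A j) (Y j x)))"
        using rect[OF J order_refl, of A "\<lambda>_. 0"] A by simp
      then have "(LINT x|M. (\<Prod>j\<in>J. indicator (A j) (X j x))) = (LINT x|N. (\<Prod>j\<in>J. indicator (A j) (Y j x)) :: real)"
        by (simp only: integral_complex_of_real of_real_eq_iff)
      then have "(LINT x|M. indicator {x\<in>space M. \<forall>i\<in>J. X i x \<in> A i} x) = (LINT x|N. indicator {x\<in>space N. \<forall>i\<in>J. Y i x \<in> A i} x :: real)"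
        by (simp add: 1[OF _ refl] cong: Bochner_Integration.integral_cong)
      then show ?thesis by (simp add: Int_def conj_ac)
    qed
    have v1: "(\<lambda>x. \<lambda>i\<in>I. X i x) -` prod_emb I (\<lambda>_. borel) J (Pi\<^sub>E J A) \<inter> space M = {x\<in>space M. \<forall>i\<in>J. X i x \<in> A i}"
      using J by (auto simp: prod_emb_def PiE_iff subset_iff)
    have v2: "(\<lambda>x. \<lambda>i\<in>I. Y i x) -` prod_emb I (\<lambda>_. borel) J (Pi\<^sub>E J A) \<inter> space N = {x\<in>space N. \<forall>i\<in>J. Y i x \<in> A i}"
      using J by (auto simp: prod_emb_def PiE_iff subset_iff)
    show "emeasure (distr M (PiM I (\<lambda>_. borel)) (\<lambda>x. \<lambda>i\<in>I. X i x)) (prod_emb I (\<lambda>_. borel) J (Pi\<^sub>E J A))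
       = emeasure (distr N (PiM I (\<lambda>_. borel)) (\<lambda>x. \<lambda>i\<in>I. Y i x)) (prod_emb I (\<lambda>_. borel) J (Pi\<^sub>E J A))"
      using emb mX mY meas by (simp add: emeasure_distr v1 v2 M.emeasure_eq_measure N.emeasure_eq_measure)
  qed (auto intro: P.finite_measure_axioms)
qed

section \<open>Strict convexity\<close>

text \<open>The inverse of \<open>v\<close> on its image is Lipschitz with constant
  \<open>1 / s\<close>, and Lipschitz maps send negligible sets to negligible sets.\<close>

lemma negligible_if_image_negligible_expanding:
  fixes v :: "real \<Rightarrow> real"
  assumes "negligible (v ` T)" and "s > 0" and exp: "\<And>x y. x \<in> T \<Longrightarrow> y \<in> T \<Longrightarrow> s * \<bar>x - y\<bar> \<le> \<bar>v x - v y\<bar>"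
  shows "negligible T"
proof -
  have inj: "inj_on v T"
    using exp \<open>s > 0\<close> by (force intro!: inj_onI simp: mult_le_0_iff)
  have "negligible (inv_into T v ` v ` T)"
  proof (rule negligible_locally_Lipschitz_image)
    fix p assume "p \<in> v ` T"
    then obtain x where x: "x \<in> T" "p = v x" by auto
    have "norm (inv_into T v y - inv_into T v p) \<le> (1 / s) * norm (y - p)" if y: "y \<in> v ` T" for y
    proof -
      obtain u where u: "u \<in> T" "y = v u" using y by auto
      show ?thesis using exp[OF u(1) x(1)] u x inj \<open>s > 0\<close> by (simp add: inv_into_f_f field_simps)
    qed
    then show "\<exists>U B. open U \<and> p \<in> U \<and> (\<forall>y\<in>v ` T \<inter> U. norm (inv_into T v y - inv_into T v p) \<le> B * norm (y - p))"
      by (intro exI[of _ UNIV] exI[of _ "1/s"]) auto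
  qed (use assms in auto)
  moreover have "inv_into T v ` v ` T = T" using inj by (force simp: inv_into_f_f)
  ultimately show ?thesis by simp
qed

text \<open>Away from a single point, a strictly convex function is locally the restriction of a
  function with slope bounded away from zero.\<close>

lemma strictly_convex_vimage_negligible:
  fixes v :: "real \<Rightarrow> real"
  assumes S: "negligible (- S)"
    and conv: "\<And>x y z. \<lbrakk>x \<in> S; y \<in> S; z \<in> S; x < y; y < z\<rbrakk> \<Longrightarrow> (v y - v x) / (y - x) < (v z - v y) / (z - y)"
    and N: "negligible N"
  shows "negligible {x \<in> S. v x \<in> N}"
proof -
  have dense: "\<exists>d\<in>S. p < d \<and> d < r" if "p < r" for p r
  proof (rule ccontr)
    assume "\<not> ?thesis"
    then have "{p<..<r} \<subseteq> - S" by auto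
    then have "negligible {p<..<r}" using S negligible_subset by blast
    then show False using open_not_negligible[of "{p<..<r}"] that by auto
  qed
  \<comment> \<open>Convexity is known only at points of the conull set \<open>S\<close>, so
    rationals cannot serve as reference points. One point of \<open>S\<close> between any two
    rationals gives a countable dense subset \<open>D\<close> of \<open>S\<close>.\<close>
  define d where "d p r = (SOME d. d \<in> S \<and> p < d \<and> d < r)" for p r :: real
  define D where "D = (\<lambda>(p, r). d p r) ` {(p, r) \<in> \<rat> \<times> \<rat>. p < r}"
  have d: "d p r \<in> S \<and> p < d p r \<and> d p r < r" if "p < r" for p r
    using someI_ex[of "\<lambda>d. d \<in> S \<and> p < d \<and> d < r"] dense[OF that] unfolding d_def by blast
  have "countable D" unfolding D_def
    by (intro countable_image countable_subset[OF _ countable_SIGMA[OF countable_rat, of "\<lambda>_. \<rat>"]]) (auto intro: countable_rat)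
  have DS: "D \<subseteq> S" unfolding D_def using d by auto
  have Ddense: "\<exists>e\<in>D. p < e \<and> e < r" if pr: "p < r" for p r :: real
  proof -
    obtain p' where p': "p' \<in> \<rat>" "p < p'" "p' < r" using Rats_dense_in_real[OF pr] by auto
    obtain r' where r': "r' \<in> \<rat>" "p' < r'" "r' < r" using Rats_dense_in_real[OF p'(3)] by auto
    have "d p' r' \<in> D" unfolding D_def using p' r' by force
    then show ?thesis using d[OF r'(2)] p' r' by (intro bexI[of _ "d p' r'"]) auto
  qed
  define G where "G = {x \<in> S. v x \<in> N}"
  have vG: "negligible (v ` T)" if "T \<subseteq> G" for T
    by (rule negligible_subset[OF N]) (use that in \<open>auto simp: G_def\<close>)
  \<comment> \<open>A secant of positive slope \<open>s\<close> ending at \<open>c\<close> bounds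
    all later slopes from below by \<open>s\<close>, so \<open>v\<close> is expanding to the right
    of \<open>c\<close>. The fact \<open>left\<close> is the mirror image.\<close>
  have right: "negligible {x \<in> G. c \<le> x}" if ac: "a \<in> D" "c \<in> D" "a < c" "v a < v c" for a c
  proof -
    define s where "s = (v c - v a) / (c - a)"
    have "s > 0" unfolding s_def using ac by simp
    have *: "s * (y - x) \<le> v y - v x" if "x \<in> S" "y \<in> S" "c \<le> x" "x < y" for x y
    proof -
      have "s < (v y - v x) / (y - x)"
      proof (cases "c = x")
        case True
        then show ?thesis using conv[of a c y] that ac DS unfolding s_def by auto
      next
        case False
        then have "s < (v x - v c) / (x - c)" using conv[of a c x] that ac DS unfolding s_def by auto
        also have "\<dots> < (v y - v x) / (y - x)" using conv[of c x y] False that ac DS by auto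
        finally show ?thesis .
      qed
      then show ?thesis using that by (simp add: field_simps)
    qed
    show ?thesis
    proof (rule negligible_if_image_negligible_expanding[OF vG \<open>s > 0\<close>])
      fix x y assume xy: "x \<in> {x \<in> G. c \<le> x}" "y \<in> {x \<in> G. c \<le> x}"
      show "s * \<bar>x - y\<bar> \<le> \<bar>v x - v y\<bar>"
        using *[of x y] *[of y x] xy by (cases x y rule: linorder_cases) (auto simp: G_def)
    qed auto
  qed
  have left: "negligible {x \<in> G. x \<le> a}" if ac: "a \<in> D" "c \<in> D" "a < c" "v c < v a" for a c
  proof -
    define s where "s = (v a - v c) / (c - a)"
    have "s > 0" unfolding s_def using ac by simp
    have sn: "(v c - v a) / (c - a) = - s" unfolding s_def by (simp add: minus_divide_left)
    have *: "s * (y - x) \<le> v x - v y" if "x \<in> S" "y \<in> S" "y \<le> a" "x < y" for x y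
    proof -
      have "(v y - v x) / (y - x) < - s"
      proof (cases "y = a")
        case True
        then show ?thesis using conv[of x a c] that ac DS unfolding sn by auto
      next
        case False
        then have "(v y - v x) / (y - x) < (v a - v y) / (a - y)" using conv[of x y a] that ac DS by auto
        also have "\<dots> < - s" using conv[of y a c] False that ac DS unfolding sn by auto
        finally show ?thesis .
      qed
      then show ?thesis using that by (simp add: field_simps)
    qed
    show ?thesis
    proof (rule negligible_if_image_negligible_expanding[OF vG \<open>s > 0\<close>])
      fix x y assume xy: "x \<in> {x \<in> G. x \<le> a}" "y \<in> {x \<in> G. x \<le> a}"
      show "s * \<bar>x - y\<bar> \<le> \<bar>v x - v y\<bar>"
        using *[of x y] *[of y x] xy by (cases x y rule: linorder_cases) (auto simp: G_def)
    qed auto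
  qed
  define U where "U = (\<Union>(a, c)\<in>{(a, c) \<in> D \<times> D. a < c \<and> v a < v c}. {x \<in> G. c \<le> x})
     \<union> (\<Union>(a, c)\<in>{(a, c) \<in> D \<times> D. a < c \<and> v c < v a}. {x \<in> G. x \<le> a})"
  have cD: "countable {(a, c) \<in> D \<times> D. P a c}" for P
    by (rule countable_subset[OF _ countable_SIGMA[OF \<open>countable D\<close>, of "\<lambda>_. D"]]) (use \<open>countable D\<close> in auto)
  have "negligible U" unfolding U_def
    by (intro negligible_Un negligible_countable_Union countable_image cD) (use left right in auto)
  \<comment> \<open>Between two points outside \<open>U\<close> no secant over \<open>D\<close>
    rises or falls, so \<open>v\<close> is constant on \<open>D\<close> there. Three points of
    \<open>D\<close> with equal values contradict strict convexity. At most one point, the minimum,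
    can escape.\<close>
  have "x = x'" if "x \<in> G - U" "x' \<in> G - U" "x \<le> x'" for x x'
  proof (rule ccontr)
    assume "x \<noteq> x'"
    then have "x < x'" using that by simp
    then obtain d1 where d1: "d1 \<in> D" "x < d1" "d1 < x'" using Ddense by blast
    then obtain d2 where d2: "d2 \<in> D" "d1 < d2" "d2 < x'" using Ddense by blast
    then obtain d3 where d3: "d3 \<in> D" "d2 < d3" "d3 < x'" using Ddense by blast
    have up: "v a \<le> v c" if "a \<in> D" "c \<in> D" "a < c" "x \<le> a" for a c
      using that \<open>x \<in> G - U\<close> unfolding U_def by force
    have down: "v c \<le> v a" if "a \<in> D" "c \<in> D" "a < c" "c \<le> x'" for a c
      using that \<open>x' \<in> G - U\<close> unfolding U_def by force
    have "v d1 = v d2" "v d2 = v d3"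
      using up[of d1 d2] up[of d2 d3] down[of d1 d2] down[of d2 d3] d1 d2 d3 by auto
    then show False using conv[of d1 d2 d3] d1 d2 d3 DS by auto
  qed
  then have "G - U = {} \<or> (\<exists>x. G - U = {x})"
    by (metis (no_types, lifting) insertI1 is_singletonI' is_singletonE linear)
  then have "negligible (G - U)" by auto
  then have "negligible ((G - U) \<union> U)" using \<open>negligible U\<close> by (rule negligible_Un)
  then show ?thesis unfolding G_def[symmetric] by (rule negligible_subset) auto
qed

text \<open>After subtraction of the linear term, the derivative has the sign of
  \<open>x - m\<close>, so \<open>m\<close> is a strict minimum. The derivative is used at positive
  points only; \<open>t = 0\<close> enters by continuity.\<close>

lemma powr_above_tangent:
  fixes t m q :: real
  assumes "1 < q" "0 < m" "0 \<le> t" "t \<noteq> m"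
  shows "m powr q + q * m powr (q - 1) * (t - m) < t powr q"
proof -
  define g where "g t = t powr q - q * m powr (q - 1) * t" for t :: real
  have cont: "continuous_on {a..b} g" if "0 \<le> a" for a b
    unfolding g_def using assms that by (intro continuous_intros continuous_on_powr') auto
  have deriv: "(g has_real_derivative q * (x powr (q - 1) - m powr (q - 1))) (at x)" if "x > 0" for x
    unfolding g_def using that by (auto intro!: derivative_eq_intros simp: algebra_simps)
  have "g m < g t"
  proof (cases "t < m")
    case True
    show ?thesis
    proof (rule DERIV_neg_imp_decreasing_open[OF True])
      fix x assume x: "t < x" "x < m"
      then have "x powr (q - 1) < m powr (q - 1)" using assms by (intro powr_less_mono2) auto
      then show "\<exists>y. (g has_real_derivative y) (at x) \<and> y < 0"
        using deriv[of x] x assms by (intro exI[of _ "q * (x powr (q - 1) - m powr (q - 1))"] conjI) (auto simp: mult_less_0_iff)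
    qed (use cont assms in auto)
  next
    case False
    then have "m < t" using assms by simp
    then show ?thesis
    proof (rule DERIV_pos_imp_increasing_open)
      fix x assume x: "m < x" "x < t"
      then have "m powr (q - 1) < x powr (q - 1)" using assms by (intro powr_less_mono2) auto
      then show "\<exists>y. (g has_real_derivative y) (at x) \<and> y > 0"
        using deriv[of x] x assms by (intro exI[of _ "q * (x powr (q - 1) - m powr (q - 1))"] conjI) auto
    qed (use cont assms in auto)
  qed
  then show ?thesis unfolding g_def by (simp add: algebra_simps)
qed

lemma abs_powr_strict_convex:
  fixes u v l q :: real
  assumes "1 < q" "0 < l" "l < 1" "u \<noteq> v"
  shows "\<bar>l * u + (1 - l) * v\<bar> powr q < l * \<bar>u\<bar> powr q + (1 - l) * \<bar>v\<bar> powr q"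
proof (cases "\<bar>l * u + (1 - l) * v\<bar> = 0")
  case True
  have "\<bar>u\<bar> > 0 \<or> \<bar>v\<bar> > 0" using assms by auto
  then have "0 < l * \<bar>u\<bar> powr q \<or> 0 < (1 - l) * \<bar>v\<bar> powr q" using assms by (cases "u = 0") auto
  moreover have "0 \<le> l * \<bar>u\<bar> powr q" "0 \<le> (1 - l) * \<bar>v\<bar> powr q" using assms by auto
  ultimately show ?thesis using True by auto
next
  case False
  define m where "m = \<bar>l * u + (1 - l) * v\<bar>"
  have m: "m > 0" using False unfolding m_def by simp
  define s where "s = sgn (l * u + (1 - l) * v)"
  have s: "m = l * (s * u) + (1 - l) * (s * v)" "\<bar>s\<bar> = 1"
    unfolding m_def s_def using False by (auto simp: sgn_if algebra_simps abs_if)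
  have *: "m powr q + q * m powr (q - 1) * (s * x - m) \<le> \<bar>x\<bar> powr q" for x
  proof -
    have "s * x \<le> \<bar>x\<bar>" using s(2) by (metis abs_le_D1 abs_mult mult_1 order_refl)
    then have "m powr q + q * m powr (q - 1) * (s * x - m) \<le> m powr q + q * m powr (q - 1) * (\<bar>x\<bar> - m)"
      using assms by (intro add_left_mono mult_left_mono) auto
    also have "\<dots> \<le> \<bar>x\<bar> powr q"
      using powr_above_tangent[OF assms(1) m, of "\<bar>x\<bar>"] by (cases "\<bar>x\<bar> = m") auto
    finally show ?thesis .
  qed
  have strict: "m powr q + q * m powr (q - 1) * (s * x - m) < \<bar>x\<bar> powr q" if "s * x \<noteq> m" for x
  proof (cases "\<bar>x\<bar> = m")
    case True
    have "s * x \<le> \<bar>x\<bar>" using s(2) by (metis abs_le_D1 abs_mult mult_1 order_refl)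
    then have "q * m powr (q - 1) * (s * x - m) < 0" using that True assms m by (intro mult_pos_neg) auto
    then show ?thesis using True by simp
  next
    case False
    have "s * x \<le> \<bar>x\<bar>" using s(2) by (metis abs_le_D1 abs_mult mult_1 order_refl)
    then have "m powr q + q * m powr (q - 1) * (s * x - m) \<le> m powr q + q * m powr (q - 1) * (\<bar>x\<bar> - m)"
      using assms by (intro add_left_mono mult_left_mono) auto
    also have "\<dots> < \<bar>x\<bar> powr q"
      using powr_above_tangent[OF assms(1) m, of "\<bar>x\<bar>"] False by auto
    finally show ?thesis .
  qed
  have ne: "s * u \<noteq> m \<or> s * v \<noteq> m" using assms s(2) by (metis abs_zero mult_cancel_left zero_neq_one)
  define c where "c = q * m powr (q - 1)"
  have eq: "m powr q = l * (m powr q + c * (s * u - m)) + (1 - l) * (m powr q + c * (s * v - m))"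
  proof -
    have "l * (m powr q + c * (s * u - m)) + (1 - l) * (m powr q + c * (s * v - m))
       = m powr q + c * (l * (s * u) + (1 - l) * (s * v) - m)" by (simp add: algebra_simps)
    then show ?thesis using s(1) by simp
  qed
  show ?thesis unfolding m_def[symmetric]
  proof (cases "s * u = m")
    case True
    then have "(1 - l) * (m powr q + c * (s * v - m)) < (1 - l) * \<bar>v\<bar> powr q"
      using strict[of v] ne assms unfolding c_def by simp
    moreover have "l * (m powr q + c * (s * u - m)) \<le> l * \<bar>u\<bar> powr q"
      using *[of u] assms unfolding c_def by simp
    ultimately show "m powr q < l * \<bar>u\<bar> powr q + (1 - l) * \<bar>v\<bar> powr q" using eq by linarith
  next
    case False
    then have "l * (m powr q + c * (s * u - m)) < l * \<bar>u\<bar> powr q"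
      using strict[of u] assms unfolding c_def by simp
    moreover have "(1 - l) * (m powr q + c * (s * v - m)) \<le> (1 - l) * \<bar>v\<bar> powr q"
      using *[of v] assms unfolding c_def by simp
    ultimately show "m powr q < l * \<bar>u\<bar> powr q + (1 - l) * \<bar>v\<bar> powr q" using eq by linarith
  qed
qed

lemma abs_powr_convex:
  fixes u v l q :: real
  assumes "1 < q" "0 < l" "l < 1"
  shows "\<bar>l * u + (1 - l) * v\<bar> powr q \<le> l * \<bar>u\<bar> powr q + (1 - l) * \<bar>v\<bar> powr q"
proof (cases "u = v")
  case True
  then show ?thesis by (simp add: algebra_simps)
next
  case False
  then show ?thesis using abs_powr_strict_convex[OF assms] by force
qed

text \<open>The pairs in question form a compact set on which the continuous convexity gap
  \<open>F\<close> is positive, so its minimum serves as \<delta>.\<close>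

lemma abs_powr_uniformly_convex:
  fixes l q R e :: real
  assumes "1 < q" "0 < l" "l < 1" "0 < e"
  obtains \<delta> where "\<delta> > 0" "\<And>u v. \<lbrakk>\<bar>u\<bar> \<le> R; \<bar>v\<bar> \<le> R; e \<le> \<bar>u - v\<bar>\<rbrakk> \<Longrightarrow>
    \<bar>l * u + (1 - l) * v\<bar> powr q + \<delta> \<le> l * \<bar>u\<bar> powr q + (1 - l) * \<bar>v\<bar> powr q"
proof -
  define A where "A = ({-R..R} \<times> {-R..R}) \<inter> {p :: real \<times> real. e \<le> \<bar>fst p - snd p\<bar>}"
  define F where "F p = l * \<bar>fst p\<bar> powr q + (1 - l) * \<bar>snd p\<bar> powr q - \<bar>l * fst p + (1 - l) * snd p\<bar> powr q" for p :: "real \<times> real"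
  have "closed {p :: real \<times> real. e \<le> \<bar>fst p - snd p\<bar>}"
    by (intro closed_Collect_le continuous_intros)
  then have "compact A" unfolding A_def by (intro compact_Int_closed compact_Times compact_Icc)
  have "continuous_on A F" unfolding F_def using assms
    by (intro continuous_intros continuous_on_powr') auto
  show thesis
  proof (cases "A = {}")
    case True
    show thesis
    proof (rule that[of 1])
      fix u v assume "\<bar>u\<bar> \<le> R" "\<bar>v\<bar> \<le> R" "e \<le> \<bar>u - v\<bar>"
      then have "(u, v) \<in> A" unfolding A_def by auto
      then show "\<bar>l * u + (1 - l) * v\<bar> powr q + 1 \<le> l * \<bar>u\<bar> powr q + (1 - l) * \<bar>v\<bar> powr q" using True by simp
    qed simp
  next
    case False
    obtain p where p: "p \<in> A" "\<And>r. r \<in> A \<Longrightarrow> F p \<le> F r"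
      using continuous_attains_inf[OF \<open>compact A\<close> False \<open>continuous_on A F\<close>] by blast
    have "fst p \<noteq> snd p" using p(1) assms unfolding A_def by auto
    then have "F p > 0" using abs_powr_strict_convex[OF assms(1-3)] unfolding F_def by force
    then show thesis
    proof (rule that)
      fix u v assume "\<bar>u\<bar> \<le> R" "\<bar>v\<bar> \<le> R" "e \<le> \<bar>u - v\<bar>"
      then have "(u, v) \<in> A" unfolding A_def by auto
      from p(2)[OF this] show "\<bar>l * u + (1 - l) * v\<bar> powr q + F p \<le> l * \<bar>u\<bar> powr q + (1 - l) * \<bar>v\<bar> powr q"
        unfolding F_def[of "(u, v)"] by simp
    qed
  qed
qed

text \<open>Markov's inequality for the counting measure.\<close>

lemma card_large_le:
  fixes f :: "'i \<Rightarrow> real"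
  assumes "finite I" "R > 0" "q > 0" "(\<Sum>k\<in>I. \<bar>f k\<bar> powr q) \<le> C"
  shows "real (card {k \<in> I. \<bar>f k\<bar> > R}) * R powr q \<le> C"
proof -
  have "real (card {k \<in> I. \<bar>f k\<bar> > R}) * R powr q = (\<Sum>k\<in>{k \<in> I. \<bar>f k\<bar> > R}. R powr q)" by simp
  also have "\<dots> \<le> (\<Sum>k\<in>{k \<in> I. \<bar>f k\<bar> > R}. \<bar>f k\<bar> powr q)"
    using assms by (intro sum_mono powr_mono2) auto
  also have "\<dots> \<le> (\<Sum>k\<in>I. \<bar>f k\<bar> powr q)" using assms by (intro sum_mono2) auto
  finally show ?thesis using assms by simp
qed

text \<open>Along a positive fraction of the indices the slopes \<open>a n k\<close> stay away from \<open>0\<close>, and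
  convergence of the averages keeps most of the arguments bounded there; so the averages are
  strictly convex uniformly in \<open>n\<close>.\<close>

lemma limit_of_powr_averages_strictly_convex:
  fixes a w :: "nat \<Rightarrow> nat \<Rightarrow> real" and b J :: nat and q \<epsilon> x y z :: real
  defines "h \<equiv> \<lambda>n x. (\<Sum>k<b^n. \<bar>a n k * x + w n k\<bar> powr q) / real b ^ n"
  assumes "1 < q" "1 \<le> b" "0 < \<epsilon>"
    and slopes: "\<And>n k. \<lbrakk>J \<le> n; b^J dvd k\<rbrakk> \<Longrightarrow> \<epsilon> \<le> \<bar>a n k\<bar>"
    and xyz: "x < y" "y < z"
    and lim: "(\<lambda>n. h n x) \<longlonglongrightarrow> vx" "(\<lambda>n. h n y) \<longlonglongrightarrow> vy" "(\<lambda>n. h n z) \<longlonglongrightarrow> vz"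
  shows "(vy - vx) / (y - x) < (vz - vy) / (z - y)"
proof -
  \<comment> \<open>The barycentric weight for which \<open>y = l * x + (1 - l) * z\<close>.\<close>
  define l where "l = (z - y) / (z - x)"
  have l: "0 < l" "l < 1" "1 - l = (y - x) / (z - x)" using xyz by (auto simp: l_def field_simps)
  have ly: "l * x + (1 - l) * z = y"
    unfolding l(3) l_def using xyz by (simp add: divide_simps) (simp add: algebra_simps)
  have bpos: "real b ^ n > 0" for n using \<open>1 \<le> b\<close> by simp
  define C where "C = max 1 (max (vx + 1) (vz + 1))"
  \<comment> \<open>With \<open>R powr q = 4 * C * b ^ J\<close>, Markov's inequality leaves at most
    \<open>b ^ n / (4 * b ^ J)\<close> indices above \<open>R\<close> at each of \<open>x\<close>
    and \<open>z\<close>. There are \<open>b ^ n / b ^ J\<close> multiples of \<open>b ^ J\<close>,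
    so at least half of them are good at both points.\<close>
  define R where "R = (4 * C * real b ^ J) powr (1 / q)"
  have C: "C > 0" unfolding C_def by simp
  have CR: "4 * C * real b ^ J > 0" using C bpos[of J] by simp
  have R: "R > 0" "R powr q = 4 * C * real b ^ J" unfolding R_def using CR \<open>1 < q\<close> \<open>1 \<le> b\<close> by (auto simp: powr_powr)
  have "\<epsilon> * (z - x) > 0" using assms by simp
  then obtain \<delta> where \<delta>: "\<delta> > 0" "\<And>u v. \<lbrakk>\<bar>u\<bar> \<le> R; \<bar>v\<bar> \<le> R; \<epsilon> * (z - x) \<le> \<bar>u - v\<bar>\<rbrakk> \<Longrightarrow>
    \<bar>l * u + (1 - l) * v\<bar> powr q + \<delta> \<le> l * \<bar>u\<bar> powr q + (1 - l) * \<bar>v\<bar> powr q"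
    using abs_powr_uniformly_convex[OF \<open>1 < q\<close> l(1,2)] by metis
  have evx: "\<forall>\<^sub>F n in sequentially. h n x < vx + 1" using lim(1) by (rule order_tendstoD) simp
  have evz: "\<forall>\<^sub>F n in sequentially. h n z < vz + 1" using lim(3) by (rule order_tendstoD) simp
  \<comment> \<open>Good indices contribute the gap \<delta>, all others at least 0 by plain
    convexity. The resulting total gap per mean does not depend on \<open>n\<close>.\<close>
  have ev: "\<forall>\<^sub>F n in sequentially. h n y + \<delta> / (2 * real b ^ J) \<le> l * h n x + (1 - l) * h n z"
    using evx evz eventually_ge_at_top[of J]
  proof eventually_elim
    case (elim n)
    define f where "f t k = a n k * t + w n k" for t k
    define D where "D = (\<lambda>i. b^J * i) ` {..<b^(n-J)}"
    have nJ: "b^n = b^J * b^(n-J)" using elim by (simp flip: power_add)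
    have Dsub: "D \<subseteq> {..<b^n}" unfolding D_def nJ using \<open>1 \<le> b\<close> by auto
    have "card D = b^(n-J)" unfolding D_def using \<open>1 \<le> b\<close> by (subst card_image) (auto intro!: inj_onI)
    then have cD: "real (card D) = real b ^ n / real b ^ J"
      using arg_cong[OF nJ, of real] bpos[of J] by (simp add: field_simps)
    define Bx where "Bx = {k \<in> {..<b^n}. \<bar>f x k\<bar> > R}"
    define Bz where "Bz = {k \<in> {..<b^n}. \<bar>f z k\<bar> > R}"
    have bad: "real (card {k \<in> {..<b^n}. \<bar>f t k\<bar> > R}) \<le> real b ^ n / (4 * real b ^ J)" if "h n t \<le> C" for t
    proof -
      have "(\<Sum>k<b^n. \<bar>f t k\<bar> powr q) \<le> C * real b ^ n"
        using that bpos[of n] unfolding h_def f_def by (simp add: field_simps)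
      from card_large_le[OF _ R(1) _ this] have "real (card {k \<in> {..<b^n}. \<bar>f t k\<bar> > R}) * (4 * C * real b ^ J) \<le> C * real b ^ n"
        using \<open>1 < q\<close> R(2) by simp
      then show ?thesis using C bpos[of J] by (simp add: field_simps)
    qed
    have cx: "real (card Bx) \<le> real b ^ n / (4 * real b ^ J)" unfolding Bx_def using elim by (intro bad) (auto simp: C_def)
    have cz: "real (card Bz) \<le> real b ^ n / (4 * real b ^ J)" unfolding Bz_def using elim by (intro bad) (auto simp: C_def)
    define E where "E = D - (Bx \<union> Bz)"
    have fin: "finite D" "finite Bx" "finite Bz" unfolding D_def Bx_def Bz_def by auto
    have "card D \<le> card (E \<union> (Bx \<union> Bz))" unfolding E_def using fin by (intro card_mono) auto
    also have "\<dots> \<le> card E + (card Bx + card Bz)"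
      by (intro order.trans[OF card_Un_le] add_left_mono card_Un_le)
    finally have "real (card D) \<le> real (card E) + real (card Bx) + real (card Bz)" by linarith
    then have "real (card E) \<ge> real b ^ n / real b ^ J - real b ^ n / (4 * real b ^ J) - real b ^ n / (4 * real b ^ J)"
      using cD cx cz by linarith
    also have "real b ^ n / real b ^ J - real b ^ n / (4 * real b ^ J) - real b ^ n / (4 * real b ^ J) = real b ^ n / (2 * real b ^ J)"
      using bpos[of J] by (simp add: field_simps)
    finally have cE: "real (card E) \<ge> real b ^ n / (2 * real b ^ J)" .
    have comb: "f y k = l * f x k + (1 - l) * f z k" for k
    proof -
      have "l * f x k + (1 - l) * f z k = a n k * (l * x + (1 - l) * z) + w n k" unfolding f_def by (simp add: algebra_simps)
      then show ?thesis unfolding ly f_def by simp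
    qed
    have summand: "\<bar>f y k\<bar> powr q + (if k \<in> E then \<delta> else 0) \<le> l * \<bar>f x k\<bar> powr q + (1 - l) * \<bar>f z k\<bar> powr q" if k: "k < b^n" for k
    proof (cases "k \<in> E")
      case True
      then have "b^J dvd k" unfolding E_def D_def by auto
      then have "\<epsilon> \<le> \<bar>a n k\<bar>" using slopes elim by blast
      moreover have "\<bar>f x k - f z k\<bar> = \<bar>a n k\<bar> * (z - x)"
      proof -
        have "f x k - f z k = a n k * (x - z)" unfolding f_def by (simp add: algebra_simps)
        then show ?thesis using xyz by (simp add: abs_mult)
      qed
      ultimately have "\<epsilon> * (z - x) \<le> \<bar>f x k - f z k\<bar>" using xyz by (simp add: mult_right_mono)
      moreover have "\<bar>f x k\<bar> \<le> R" "\<bar>f z k\<bar> \<le> R" using True k unfolding E_def Bx_def Bz_def by auto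
      ultimately show ?thesis using \<delta>(2) True comb by simp
    next
      case False
      then show ?thesis using abs_powr_convex[OF \<open>1 < q\<close> l(1,2)] comb by simp
    qed
    have "(\<Sum>k<b^n. \<bar>f y k\<bar> powr q) + (\<Sum>k<b^n. if k \<in> E then \<delta> else 0)
       \<le> (\<Sum>k<b^n. l * \<bar>f x k\<bar> powr q + (1 - l) * \<bar>f z k\<bar> powr q)"
      unfolding sum.distrib[symmetric] using summand by (intro sum_mono) auto
    moreover have "(\<Sum>k<b^n. if k \<in> E then \<delta> else 0) = real (card E) * \<delta>"
    proof -
      have "{..<b^n} \<inter> E = E" using Dsub unfolding E_def by auto
      then show ?thesis by (simp flip: sum.inter_restrict)
    qed
    moreover have "real (card E) * \<delta> \<ge> real b ^ n / (2 * real b ^ J) * \<delta>" using cE \<delta> by (intro mult_right_mono) auto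
    ultimately have "(\<Sum>k<b^n. \<bar>f y k\<bar> powr q) + real b ^ n / (2 * real b ^ J) * \<delta>
       \<le> l * (\<Sum>k<b^n. \<bar>f x k\<bar> powr q) + (1 - l) * (\<Sum>k<b^n. \<bar>f z k\<bar> powr q)"
      by (simp add: sum.distrib sum_distrib_left)
    then have "((\<Sum>k<b^n. \<bar>f y k\<bar> powr q) + real b ^ n / (2 * real b ^ J) * \<delta>) / real b ^ n
       \<le> (l * (\<Sum>k<b^n. \<bar>f x k\<bar> powr q) + (1 - l) * (\<Sum>k<b^n. \<bar>f z k\<bar> powr q)) / real b ^ n"
      using bpos[of n] by (intro divide_right_mono) auto
    then show ?case unfolding h_def f_def[symmetric] using \<open>1 \<le> b\<close> by (simp add: add_divide_distrib)
  qed
  have "vy + \<delta> / (2 * real b ^ J) \<le> l * vx + (1 - l) * vz"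
    by (rule tendsto_le[OF _ _ _ ev]) (use lim in \<open>auto intro!: tendsto_intros\<close>)
  moreover have "\<delta> / (2 * real b ^ J) > 0" using \<delta> bpos[of J] by simp
  ultimately have "vy < l * vx + (1 - l) * vz" by linarith
  then have "vy * (z - x) < (l * vx + (1 - l) * vz) * (z - x)" using xyz by simp
  also have "\<dots> = (l * (z - x)) * vx + ((1 - l) * (z - x)) * vz" by (simp add: algebra_simps)
  also have "\<dots> = (z - y) * vx + (y - x) * vz" unfolding l(3) unfolding l_def using xyz by simp
  finally have "vy * (z - x) < (z - y) * vx + (y - x) * vz" .
  then have "(vy - vx) * (z - y) < (vz - vy) * (y - x)" by (simp add: algebra_simps)
  then show ?thesis using xyz by (simp add: field_simps)
qed

section \<open>Centered Gaussian variables\<close>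

text \<open>Both alternatives in \<open>gaussian_rv\<close> become scalings of the standard normal
  law, with \<sigma> = 0 for the degenerate one. Moments and characteristic functions can then be
  computed without a case distinction.\<close>

lemma gaussian_rv_law:
  assumes "prob_space M" "gaussian_rv M X" "(\<integral>\<omega>. X \<omega> \<partial>M) = 0"
  obtains \<sigma> where "distr M borel X = distr std_normal_distribution borel (\<lambda>x. \<sigma> * x)"
proof -
  interpret prob_space M by fact
  interpret std: real_distribution std_normal_distribution by (rule real_dist_normal_dist)
  have X[measurable]: "X \<in> borel_measurable M" using assms unfolding gaussian_rv_def by blast
  from assms(2) obtain \<mu> \<sigma> where
    "(\<sigma> > 0 \<and> distributed M lborel X (\<lambda>x. ennreal (normal_density \<mu> \<sigma> x))) \<or> (AE \<omega> in M. X \<omega> = \<mu>)"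
    unfolding gaussian_rv_def by blast
  then show thesis
  proof
    assume *: "\<sigma> > 0 \<and> distributed M lborel X (\<lambda>x. ennreal (normal_density \<mu> \<sigma> x))"
    then have "\<mu> = 0" using normal_distributed_expectation[of \<sigma> X \<mu>] assms(3) by simp
    then have "distributed M lborel (\<lambda>x. X x / \<sigma>) std_normal_density"
      using * normal_standard_normal_convert[of \<sigma> X 0] by simp
    then have std: "distr M lborel (\<lambda>x. X x / \<sigma>) = std_normal_distribution"
      by (rule distributed_distr_eq_density)
    have "distr M borel X = distr M borel (\<lambda>x. \<sigma> * (X x / \<sigma>))" using * by simp
    also have "\<dots> = distr (distr M lborel (\<lambda>x. X x / \<sigma>)) borel (\<lambda>x. \<sigma> * x)"
      by (subst distr_distr) (auto simp: comp_def)
    finally show thesis using that unfolding std by blast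
  next
    assume *: "AE \<omega> in M. X \<omega> = \<mu>"
    then have "(\<integral>\<omega>. X \<omega> \<partial>M) = (\<integral>\<omega>. \<mu> \<partial>M)" by (intro integral_cong_AE) auto
    then have "\<mu> = 0" using assms(3) by (simp add: prob_space)
    have "distr M borel X = distr M borel (\<lambda>_. 0)"
      using * \<open>\<mu> = 0\<close> by (intro distr_cong_AE) auto
    also have "\<dots> = return borel 0" by (rule distr_const) simp
    also have "\<dots> = distr std_normal_distribution borel (\<lambda>x. 0 * x)" by (simp add: std.distr_const)
    finally show thesis by (rule that)
  qed
qed

lemma gaussian_rv_moments:
  assumes "prob_space M" "gaussian_rv M X" "(\<integral>\<omega>. X \<omega> \<partial>M) = 0"
  shows "integrable M (\<lambda>\<omega>. X \<omega> ^ n)" (is ?int)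
    and "(\<integral>\<omega>. X \<omega> ^ (2 * k) \<partial>M) = fact (2 * k) / (2 ^ k * fact k) * (\<integral>\<omega>. X \<omega> ^ 2 \<partial>M) ^ k" (is ?mom)
    and "(CLINT \<omega>|M. iexp (X \<omega>)) = of_real (exp (- (\<integral>\<omega>. X \<omega> ^ 2 \<partial>M) / 2))" (is ?char)
proof -
  obtain \<sigma> where law: "distr M borel X = distr std_normal_distribution borel (\<lambda>x. \<sigma> * x)"
    using gaussian_rv_law[OF assms] .
  have X[measurable]: "X \<in> borel_measurable M" using assms unfolding gaussian_rv_def by blast
  have int: "integrable M (\<lambda>\<omega>. X \<omega> ^ n)" for n
  proof -
    have "integrable std_normal_distribution (\<lambda>x. (\<sigma> * x) ^ n)"
      unfolding power_mult_distrib by (intro integrable_mult_right integrable_std_normal_distribution_moment)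
    then have "integrable (distr M borel X) (\<lambda>x. x ^ n)"
      unfolding law by (subst integrable_distr_eq) auto
    then show ?thesis by (subst (asm) integrable_distr_eq) auto
  qed
  show ?int by (rule int)
  have tr: "(\<integral>\<omega>. f (X \<omega>) \<partial>M) = (\<integral>x. f (\<sigma> * x) \<partial>std_normal_distribution)"
    if "f \<in> borel_measurable borel" for f :: "real \<Rightarrow> 'b::{banach, second_countable_topology}"
  proof -
    have "(\<integral>\<omega>. f (X \<omega>) \<partial>M) = (\<integral>x. f x \<partial>distr M borel X)" using that by (simp add: integral_distr)
    then show ?thesis unfolding law using that by (simp add: integral_distr)
  qed
  have m: "(\<integral>\<omega>. X \<omega> ^ (2 * k) \<partial>M) = \<sigma> ^ (2 * k) * (fact (2 * k) / (2 ^ k * fact k))" for k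
    using tr[of "\<lambda>x. x ^ (2 * k)"] by (simp add: power_mult_distrib std_normal_distribution_even_moments)
  have m2: "(\<integral>\<omega>. X \<omega> ^ 2 \<partial>M) = \<sigma>\<^sup>2" using m[of 1] by simp
  show ?mom unfolding m m2 by (simp add: power_mult)
  have "(CLINT \<omega>|M. iexp (X \<omega>)) = char std_normal_distribution \<sigma>"
    using tr[of "\<lambda>x. iexp x"] by (simp add: char_def)
  then show ?char unfolding m2 char_std_normal_distribution by simp
qed

section \<open>Increments of the bridge\<close>

lemma frac_nat_divide:
  fixes k m :: nat
  assumes "m > 0"
  shows "frac (real k / real m) = real (k mod m) / real m"
proof -
  have "real k / real m - real (k mod m) / real m = real (k div m)"
    using of_nat_of_nat_div_aux[of k m, where 'a=real] by simp
  then show ?thesis using assms by (simp add: frac_unique_iff)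
qed

lemma frac_Suc_divide_cases:
  fixes k m :: nat
  assumes "m > 0"
  defines "x \<equiv> frac (real k / real m)" and "y \<equiv> frac ((real k + 1) / real m)"
  shows "(0 \<le> x \<and> y = x + 1 / real m \<and> y \<le> 1) \<or> (y = 0 \<and> x = 1 - 1 / real m \<and> 0 \<le> x)"
proof -
  have y: "y = real (Suc k mod m) / real m"
    unfolding y_def using frac_nat_divide[OF assms(1), of "Suc k"] by (simp add: add.commute)
  have x: "x = real (k mod m) / real m" unfolding x_def using assms by (intro frac_nat_divide)
  show ?thesis
  proof (cases "Suc (k mod m) = m")
    case True
    then have "real (k mod m) = real m - 1" by linarith
    then show ?thesis using True assms(1) unfolding x y by (simp add: mod_Suc field_simps)
  next
    case False
    then have "Suc (k mod m) \<le> m" using assms(1) by (simp add: Suc_leI)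
    then show ?thesis using False assms(1) unfolding x y by (simp add: mod_Suc field_simps flip: of_nat_Suc)
  qed
qed

text \<open>After division by \<open>x + y\<close> the terms lie in the unit interval, where
  \<open>t \<le> t powr H\<close>.\<close>

lemma powr_add_le_add_powr:
  fixes x y H :: real
  assumes "0 \<le> x" "0 \<le> y" "0 < H" "H \<le> 1"
  shows "(x + y) powr H \<le> x powr H + y powr H"
proof (cases "x + y = 0")
  case False
  then have s: "x + y > 0" using assms by simp
  have *: "t \<le> t powr H" if "0 \<le> t" "t \<le> 1" for t :: real
    using powr_mono'[of H 1 t] that assms by simp
  have "1 = x / (x + y) + y / (x + y)" using s by (simp flip: add_divide_distrib)
  also have "\<dots> \<le> (x / (x + y)) powr H + (y / (x + y)) powr H"
    using assms s by (intro add_mono *) auto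
  also have "\<dots> = (x powr H + y powr H) / (x + y) powr H"
    using assms s by (simp add: powr_divide add_divide_distrib)
  finally show ?thesis using s by (simp add: field_simps)
qed (use assms in auto)

lemma abs_powr_diff_le:
  fixes x y H :: real
  assumes "0 \<le> x" "0 \<le> y" "0 < H" "H \<le> 1"
  shows "\<bar>x powr H - y powr H\<bar> \<le> \<bar>x - y\<bar> powr H"
  using powr_add_le_add_powr[of "x - y" y H] powr_add_le_add_powr[of "y - x" x H] assms powr_mono2[of H x y] powr_mono2[of H y x]
  by (cases "x \<le> y") auto

section \<open>The covariance of fractional Brownian motion and its regularity\<close>

definition fBm_cov :: "real \<Rightarrow> real \<Rightarrow> real \<Rightarrow> real" where
  "fBm_cov H s t = (1/2) * (s powr (2 * H) + t powr (2 * H) - \<bar>t - s\<bar> powr (2 * H))"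

lemma fBm_cov_0: "0 \<le> t \<Longrightarrow> fBm_cov H 0 t = 0"
  by (simp add: fBm_cov_def)

lemma fBm_cov_refl: "fBm_cov H t t = t powr (2 * H)"
  by (simp add: fBm_cov_def)

lemma fBm_cov_commute: "fBm_cov H s t = fBm_cov H t s"
  by (simp add: fBm_cov_def abs_minus_commute)

lemma fBm_cov_scale:
  assumes "0 \<le> u" "0 \<le> s" "0 \<le> t"
  shows "fBm_cov H (u * s) (u * t) = u powr (2 * H) * fBm_cov H s t"
proof -
  have "\<bar>u * t - u * s\<bar> = u * \<bar>t - s\<bar>" using assms by (simp add: abs_mult flip: right_diff_distrib)
  then show ?thesis using assms by (simp add: fBm_cov_def powr_mult algebra_simps)
qed

text \<open>Writing \<open>x powr (2 * H)\<close> as the square of \<open>x powr H\<close> and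
  factoring the difference of squares gives the exponent \<open>H\<close> for every \<open>H\<close>
  in (0, 1), also where \<open>2 * H\<close> exceeds 1. The second factor is at most 2 on the unit
  interval.\<close>

lemma fBm_cov_holder:
  assumes H: "0 < H" "H < 1" and s: "s \<in> {0..1}" "s' \<in> {0..1}" and t: "t \<in> {0..1}"
  shows "\<bar>fBm_cov H s t - fBm_cov H s' t\<bar> \<le> 2 * \<bar>s - s'\<bar> powr H"
proof -
  have *: "\<bar>x powr (2 * H) - y powr (2 * H)\<bar> \<le> 2 * \<bar>x - y\<bar> powr H" if "x \<in> {0..1}" "y \<in> {0..1}" for x y :: real
  proof -
    have sq: "z powr (2 * H) = (z powr H)^2" for z :: real
      by (simp add: power2_eq_square flip: powr_add)
    have "x powr (2 * H) - y powr (2 * H) = (x powr H - y powr H) * (x powr H + y powr H)"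
      unfolding sq by (simp add: power2_eq_square algebra_simps)
    then have "\<bar>x powr (2 * H) - y powr (2 * H)\<bar> = \<bar>x powr H - y powr H\<bar> * (x powr H + y powr H)"
      by (simp add: abs_mult)
    also have "\<dots> \<le> \<bar>x - y\<bar> powr H * 2"
      using that H powr_le1[of H x] powr_le1[of H y] by (intro mult_mono abs_powr_diff_le) auto
    finally show ?thesis by simp
  qed
  have "\<bar>fBm_cov H s t - fBm_cov H s' t\<bar> = (1/2) * \<bar>(s powr (2 * H) - s' powr (2 * H)) - (\<bar>t - s\<bar> powr (2 * H) - \<bar>t - s'\<bar> powr (2 * H))\<bar>"
    unfolding fBm_cov_def by (simp add: algebra_simps abs_if)
  also have "\<dots> \<le> (1/2) * (\<bar>s powr (2 * H) - s' powr (2 * H)\<bar> + \<bar>\<bar>t - s\<bar> powr (2 * H) - \<bar>t - s'\<bar> powr (2 * H)\<bar>)"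
    by (intro mult_left_mono abs_triangle_ineq4) auto
  also have "\<dots> \<le> (1/2) * (2 * \<bar>s - s'\<bar> powr H + 2 * \<bar>\<bar>t - s\<bar> - \<bar>t - s'\<bar>\<bar> powr H)"
    using s t by (intro mult_left_mono add_mono *) (auto simp: abs_if)
  also have "\<dots> \<le> (1/2) * (2 * \<bar>s - s'\<bar> powr H + 2 * \<bar>s - s'\<bar> powr H)"
    using H by (intro mult_left_mono add_mono powr_mono2) (auto simp: abs_if)
  finally show ?thesis by simp
qed

text \<open>The condition \<open>rough\<close> is \<open>H > K\<close> in exponential form. For
  \<kappa> the exponent \<open>H\<close> is enough, since its increments need only be as small as
  those of the paths.\<close>

locale weierstrass_bridge =
  fixes \<alpha> H C :: real and b :: nat and \<kappa> :: "real \<Rightarrow> real"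
  assumes alpha: "0 < \<alpha>" "\<alpha> < 1" and H: "0 < H" "H < 1" and b: "2 \<le> b"
    and rough: "real b powr (- H) < \<alpha>"
    and kappa: "\<kappa> 0 = 0" "\<kappa> 1 = 1"
    and kappa_holder: "\<And>s t. \<lbrakk>s \<in> {0..1}; t \<in> {0..1}\<rbrakk> \<Longrightarrow> \<bar>\<kappa> s - \<kappa> t\<bar> \<le> C * \<bar>s - t\<bar> powr H"
begin

section \<open>Increments on the grid and their geometric decay\<close>

definition bridge :: "(real \<Rightarrow> real) \<Rightarrow> real \<Rightarrow> real" where
  "bridge f u = f u - \<kappa> u * f 1"

definition bridge_incr :: "nat \<Rightarrow> nat \<Rightarrow> (real \<Rightarrow> real) \<Rightarrow> real" where
  "bridge_incr j k f = bridge f (frac ((real k + 1) / real b ^ j)) - bridge f (frac (real k / real b ^ j))"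

text \<open>This is the increment of the Weierstrass series over the \<open>k\<close>-th cell of
  level \<open>n\<close>, divided by \<open>\<alpha> ^ n\<close>; the term with index
  \<open>j\<close> comes from summand \<open>n - j\<close> of the series.\<close>

definition scaled_incr :: "nat \<Rightarrow> nat \<Rightarrow> (real \<Rightarrow> real) \<Rightarrow> real" where
  "scaled_incr n k f = (\<Sum>j=1..n. bridge_incr j k f / \<alpha> ^ j)"

definition ratio :: real where "ratio = real b powr (- H) / \<alpha>"

lemma ratio: "0 < ratio" "ratio < 1"
  using b alpha rough by (auto simp: ratio_def)

lemma C_nonneg: "0 \<le> C"
  using kappa_holder[of 0 1] kappa by simp

lemma mesh_powr: "(1 / real b ^ j) powr H = (real b powr (- H)) ^ j"
  using b by (simp add: powr_minus_divide powr_divide powr_power powr_realpow[symmetric] powr_powr power_one_over mult.commute)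

text \<open>At points \<open>i / b ^ n\<close> all summands from index \<open>n\<close> on have an
  integer argument, so they equal a multiple of \<open>bridge f 0\<close> and cancel in the
  difference. The remaining finite sum is reindexed by \<open>j = n - m\<close>.\<close>

lemma weierstrass_increment:
  assumes f: "\<And>u. fractional_bridge \<kappa> W u \<omega> = bridge f u"
  shows "wiener_weierstrass_bridge \<alpha> b \<kappa> W ((real k + 1) / real b ^ n) \<omega>
      - wiener_weierstrass_bridge \<alpha> b \<kappa> W (real k / real b ^ n) \<omega> = \<alpha> ^ n * scaled_incr n k f"
proof -
  have bp: "real b > 0" using b by simp
  have Y: "wiener_weierstrass_bridge \<alpha> b \<kappa> W (real i / real b ^ n) \<omega> =
     (\<Sum>m. \<alpha> ^ (m + n) * bridge f 0) + (\<Sum>m<n. \<alpha> ^ m * bridge f (frac (real i / real b ^ (n - m))))" for i :: nat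
  proof -
    have tail: "\<alpha> ^ (m + n) * bridge f (frac (real b ^ (m + n) * (real i / real b ^ n))) = \<alpha> ^ (m + n) * bridge f 0" for m
    proof -
      have "real b ^ (m + n) * (real i / real b ^ n) = of_nat (b ^ m * i)" using bp by (simp add: power_add)
      then show ?thesis by (simp only: Ints_of_nat frac_eq_0_iff[THEN iffD2])
    qed
    have "summable (\<lambda>m. \<alpha> ^ (m + n) * bridge f 0)"
      unfolding power_add using alpha by (intro summable_mult2 summable_geometric) auto
    then have "summable (\<lambda>m. \<alpha> ^ (m + n) * bridge f (frac (real b ^ (m + n) * (real i / real b ^ n))))"
      unfolding tail .
    then have sm: "summable (\<lambda>m. \<alpha> ^ m * bridge f (frac (real b ^ m * (real i / real b ^ n))))"
      using summable_iff_shift[of "\<lambda>m. \<alpha> ^ m * bridge f (frac (real b ^ m * (real i / real b ^ n)))" n] by simp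
    have "real b ^ m * (real i / real b ^ n) = real i / real b ^ (n - m)" if "m < n" for m
      using that bp by (simp add: power_diff)
    then have "(\<Sum>m<n. \<alpha> ^ m * bridge f (frac (real b ^ m * (real i / real b ^ n)))) = (\<Sum>m<n. \<alpha> ^ m * bridge f (frac (real i / real b ^ (n - m))))"
      by (intro sum.cong) auto
    then show ?thesis
      unfolding wiener_weierstrass_bridge_def f
      using suminf_split_initial_segment[OF sm, of n] unfolding tail by simp
  qed
  have "wiener_weierstrass_bridge \<alpha> b \<kappa> W ((real k + 1) / real b ^ n) \<omega> - wiener_weierstrass_bridge \<alpha> b \<kappa> W (real k / real b ^ n) \<omega>
    = (\<Sum>m<n. \<alpha> ^ m * bridge_incr (n - m) k f)"
    using Y[of "Suc k"] Y[of k] by (simp add: bridge_incr_def right_diff_distrib sum_subtractf add.commute)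
  also have "\<dots> = (\<Sum>j=1..n. \<alpha> ^ (n - j) * bridge_incr j k f)"
    by (rule sum.reindex_bij_witness[where i="\<lambda>j. n - j" and j="\<lambda>m. n - m"]) auto
  also have "\<dots> = \<alpha> ^ n * scaled_incr n k f"
    unfolding scaled_incr_def sum_distrib_left using alpha by (intro sum.cong) (auto simp: power_diff)
  finally show ?thesis .
qed

lemma bridge_incr_affine: "bridge_incr j k (\<lambda>t. x * f t + g t) = x * bridge_incr j k f + bridge_incr j k g"
  by (simp add: bridge_incr_def bridge_def algebra_simps)

lemma scaled_incr_affine: "scaled_incr n k (\<lambda>t. f t * x + g t) = scaled_incr n k f * x + scaled_incr n k g"
proof -
  have "scaled_incr n k (\<lambda>t. x * f t + g t) = x * scaled_incr n k f + scaled_incr n k g"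
    by (simp add: scaled_incr_def bridge_incr_affine add_divide_distrib sum.distrib sum_distrib_left)
  then show ?thesis by (simp add: mult.commute)
qed

text \<open>Both \<open>bridge f 0\<close> and \<open>bridge f 1\<close> vanish, so a jump of the fractional part from near \<open>1\<close>
  to \<open>0\<close> is no exception.\<close>

lemma bridge_incr_cases:
  obtains s t where "s \<in> {0..1}" "t \<in> {0..1}" "t - s = 1 / real b ^ j"
    "\<And>f. f 0 = 0 \<Longrightarrow> bridge_incr j k f = f t - f s - (\<kappa> t - \<kappa> s) * f 1"
proof -
  have bp: "b ^ j > 0" using b by simp
  from frac_Suc_divide_cases[OF bp, of k] show thesis
  proof
    assume "0 \<le> frac (real k / real (b ^ j)) \<and> frac ((real k + 1) / real (b ^ j)) = frac (real k / real (b ^ j)) + 1 / real (b ^ j) \<and> frac ((real k + 1) / real (b ^ j)) \<le> 1"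
    then show thesis
      by (intro that[of "frac (real k / real (b ^ j))" "frac ((real k + 1) / real (b ^ j))"])
         (auto simp: bridge_incr_def bridge_def algebra_simps intro: less_imp_le[OF frac_lt_1])
  next
    assume "frac ((real k + 1) / real (b ^ j)) = 0 \<and> frac (real k / real (b ^ j)) = 1 - 1 / real (b ^ j) \<and> 0 \<le> frac (real k / real (b ^ j))"
    then show thesis
      by (intro that[of "frac (real k / real (b ^ j))" 1])
         (auto simp: bridge_incr_def bridge_def algebra_simps kappa intro: less_imp_le[OF frac_lt_1] simp del: frac_eq_0_iff)
  qed
qed

text \<open>The bridge of \<open>f\<close> is Hoelder with constant
  \<open>A + C * \<bar>f 1\<bar>\<close>, and \<open>bridge_incr_cases\<close> ensures that the two
  endpoints are exactly one mesh apart even at a wrap.\<close>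

lemma bridge_incr_bound:
  assumes "f 0 = 0" and hol: "\<And>s t. \<lbrakk>s \<in> {0..1}; t \<in> {0..1}\<rbrakk> \<Longrightarrow> \<bar>f s - f t\<bar> \<le> A * \<bar>s - t\<bar> powr H"
  shows "\<bar>bridge_incr j k f / \<alpha> ^ j\<bar> \<le> (A + C * \<bar>f 1\<bar>) * ratio ^ j"
proof -
  obtain s t where st: "s \<in> {0..1}" "t \<in> {0..1}" "t - s = 1 / real b ^ j" "bridge_incr j k f = f t - f s - (\<kappa> t - \<kappa> s) * f 1"
    using bridge_incr_cases[of j k] assms(1) by metis
  have p: "\<bar>t - s\<bar> powr H = (real b powr (- H)) ^ j" unfolding st(3) mesh_powr[symmetric] by simp
  have "\<bar>bridge_incr j k f\<bar> \<le> \<bar>f t - f s\<bar> + \<bar>\<kappa> t - \<kappa> s\<bar> * \<bar>f 1\<bar>"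
    unfolding st(4) abs_mult[symmetric] by (rule abs_triangle_ineq4)
  also have "\<dots> \<le> A * \<bar>t - s\<bar> powr H + (C * \<bar>t - s\<bar> powr H) * \<bar>f 1\<bar>"
    using st by (intro add_mono mult_right_mono hol kappa_holder) auto
  also have "\<dots> = (A + C * \<bar>f 1\<bar>) * (real b powr (- H)) ^ j" unfolding p by (simp add: algebra_simps)
  finally have "\<bar>bridge_incr j k f\<bar> / \<alpha> ^ j \<le> (A + C * \<bar>f 1\<bar>) * (real b powr (- H)) ^ j / \<alpha> ^ j"
    using alpha by (intro divide_right_mono) auto
  then show ?thesis using alpha by (simp add: ratio_def power_divide)
qed

text \<open>As \<open>f\<close> vanishes at 0, its value at \<open>1 / b ^ Suc j\<close> is at most
  \<open>A\<close> times the mesh to the power \<open>H\<close>; division by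
  \<open>\<alpha> ^ Suc j\<close> leaves a geometric majorant. It is applied to bridges, to \<kappa>
  and to the covariance.\<close>

lemma holder_series_summable:
  assumes f: "f 0 = 0" and hol: "\<And>s t. \<lbrakk>s \<in> {0..1}; t \<in> {0..1}\<rbrakk> \<Longrightarrow> \<bar>f s - f t\<bar> \<le> A * \<bar>s - t\<bar> powr H"
  shows "summable (\<lambda>j. f (1 / real b ^ Suc j) / \<alpha> ^ Suc j)"
proof (rule summable_comparison_test')
  show "summable (\<lambda>j. A * ratio ^ Suc j)"
    unfolding power_Suc using ratio by (intro summable_mult summable_geometric) auto
  fix j :: nat
  have "\<bar>f (1 / real b ^ Suc j)\<bar> \<le> A * (1 / real b ^ Suc j) powr H"
    using hol[of "1 / real b ^ Suc j" 0] f b one_le_power[of "real b" "Suc j"] by (simp del: power_Suc)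
  also have "\<dots> = A * (real b powr (- H)) ^ Suc j" by (simp only: mesh_powr)
  finally have "\<bar>f (1 / real b ^ Suc j)\<bar> / \<alpha> ^ Suc j \<le> A * (real b powr (- H)) ^ Suc j / \<alpha> ^ Suc j"
    using alpha by (intro divide_right_mono) auto
  also have "\<dots> = A * ratio ^ Suc j" by (simp add: ratio_def power_divide)
  finally show "norm (f (1 / real b ^ Suc j) / \<alpha> ^ Suc j) \<le> A * ratio ^ Suc j" using alpha by simp
qed

text \<open>The limit of \<open>scaled_incr n k f\<close> along indices \<open>k\<close> divisible by ever higher powers of \<open>b\<close>.\<close>

definition slope :: "(real \<Rightarrow> real) \<Rightarrow> real" where
  "slope f = (\<Sum>j. bridge f (1 / real b ^ Suc j) / \<alpha> ^ Suc j)"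

lemma bridge_incr_multiple:
  assumes "f 0 = 0" "1 \<le> j" "b ^ j dvd k"
  shows "bridge_incr j k f = bridge f (1 / real b ^ j)"
proof -
  obtain i where i: "k = b ^ j * i" using assms by blast
  have bp: "real b ^ j > 0" "b ^ j > 1" using b assms one_less_power[of b j] by auto
  then have "1 / real b ^ j < 1" by (metis divide_less_eq_1_pos of_nat_1 of_nat_less_iff of_nat_power)
  then have "frac ((real k + 1) / real b ^ j) = 1 / real b ^ j" "frac (real k / real b ^ j) = 0"
    using bp unfolding i by (auto simp: add_divide_distrib frac_unique_iff)
  then show ?thesis using assms kappa by (simp add: bridge_incr_def bridge_def del: frac_eq_0_iff)
qed

text \<open>If \<open>b ^ J\<close> divides \<open>k\<close>, the first \<open>J\<close> terms are
  exactly a partial sum of \<open>slope f\<close>, and the others have a geometric bound uniform in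
  \<open>n\<close> and \<open>k\<close>. For suitable \<open>J\<close> the partial sum exceeds half
  of \<open>\<bar>slope f\<bar>\<close> and the tail stays below a quarter, which leaves a quarter
  for \<epsilon>.\<close>

lemma scaled_incr_lower:
  assumes f: "f 0 = 0" and hol: "\<And>s t. \<lbrakk>s \<in> {0..1}; t \<in> {0..1}\<rbrakk> \<Longrightarrow> \<bar>f s - f t\<bar> \<le> A * \<bar>s - t\<bar> powr H"
    and nz: "slope f \<noteq> 0"
  shows "\<exists>\<epsilon>>0. \<exists>J. \<forall>n k. J \<le> n \<longrightarrow> b ^ J dvd k \<longrightarrow> \<epsilon> \<le> \<bar>scaled_incr n k f\<bar>"
proof -
  define A' where "A' = A + C * \<bar>f 1\<bar>"
  have A: "A \<ge> 0" using hol[of 0 1] by simp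
  have A': "A' \<ge> 0" unfolding A'_def using A C_nonneg by simp
  have sm: "summable (\<lambda>j. bridge f (1 / real b ^ Suc j) / \<alpha> ^ Suc j)"
  proof (rule holder_series_summable)
    show "bridge f 0 = 0" by (simp add: bridge_def f kappa)
    fix s t :: real assume st: "s \<in> {0..1}" "t \<in> {0..1}"
    have "bridge f s - bridge f t = (f s - f t) - (\<kappa> s - \<kappa> t) * f 1" by (simp add: bridge_def algebra_simps)
    then have "\<bar>bridge f s - bridge f t\<bar> \<le> \<bar>f s - f t\<bar> + \<bar>\<kappa> s - \<kappa> t\<bar> * \<bar>f 1\<bar>"
      unfolding abs_mult[symmetric] by (metis abs_triangle_ineq4)
    also have "\<dots> \<le> A * \<bar>s - t\<bar> powr H + (C * \<bar>s - t\<bar> powr H) * \<bar>f 1\<bar>"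
      using st by (intro add_mono mult_right_mono hol kappa_holder) auto
    finally show "\<bar>bridge f s - bridge f t\<bar> \<le> A' * \<bar>s - t\<bar> powr H" by (simp add: A'_def algebra_simps)
  qed
  define P where "P J = (\<Sum>j<J. bridge f (1 / real b ^ Suc j) / \<alpha> ^ Suc j)" for J
  have "P \<longlonglongrightarrow> slope f" unfolding P_def slope_def using sm by (rule summable_LIMSEQ)
  then have "(\<lambda>J. \<bar>P J\<bar>) \<longlonglongrightarrow> \<bar>slope f\<bar>" by (rule tendsto_rabs)
  then have ev1: "\<forall>\<^sub>F J in sequentially. \<bar>slope f\<bar> / 2 < \<bar>P J\<bar>"
    by (rule order_tendstoD) (use nz in auto)
  have "(\<lambda>J. A' * (ratio ^ J / (1 - ratio))) \<longlonglongrightarrow> A' * (0 / (1 - ratio))"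
    using ratio by (intro tendsto_intros LIMSEQ_power_zero) auto
  then have ev2: "\<forall>\<^sub>F J in sequentially. A' * (ratio ^ J / (1 - ratio)) < \<bar>slope f\<bar> / 4"
    by (rule order_tendstoD) (use nz in auto)
  obtain J where J: "\<bar>slope f\<bar> / 2 < \<bar>P J\<bar>" "A' * (ratio ^ J / (1 - ratio)) < \<bar>slope f\<bar> / 4"
    using eventually_happens'[OF _ eventually_conj[OF ev1 ev2]] by auto
  have "\<bar>slope f\<bar> / 4 \<le> \<bar>scaled_incr n k f\<bar>" if n: "J \<le> n" and k: "b ^ J dvd k" for n k
  proof -
    have "scaled_incr n k f = (\<Sum>j=1..J. bridge_incr j k f / \<alpha> ^ j) + (\<Sum>j=Suc J..n. bridge_incr j k f / \<alpha> ^ j)"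
      unfolding scaled_incr_def using n sum.ub_add_nat[of 1 J "\<lambda>j. bridge_incr j k f / \<alpha> ^ j" "n - J"] by simp
    also have "(\<Sum>j=1..J. bridge_incr j k f / \<alpha> ^ j) = P J"
    proof -
      have "(\<Sum>j=1..J. bridge_incr j k f / \<alpha> ^ j) = (\<Sum>j=1..J. bridge f (1 / real b ^ j) / \<alpha> ^ j)"
        using k by (intro sum.cong refl, subst bridge_incr_multiple) (auto simp: f intro: dvd_trans[OF le_imp_power_dvd])
      also have "\<dots> = P J" unfolding P_def
        by (rule sum.reindex_bij_witness[where i=Suc and j="\<lambda>j. j - 1"]) auto
      finally show ?thesis .
    qed
    finally have eq: "scaled_incr n k f = P J + (\<Sum>j=Suc J..n. bridge_incr j k f / \<alpha> ^ j)" .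
    have "\<bar>\<Sum>j=Suc J..n. bridge_incr j k f / \<alpha> ^ j\<bar> \<le> (\<Sum>j=Suc J..n. A' * ratio ^ j)"
      unfolding A'_def by (rule order.trans[OF sum_abs]) (intro sum_mono bridge_incr_bound[OF f hol])
    also have "\<dots> \<le> A' * (ratio ^ J / (1 - ratio))"
    proof -
      have "(\<Sum>j=Suc J..n. ratio ^ j) \<le> (\<Sum>j=J..n. ratio ^ j)" using ratio by (intro sum_mono2) auto
      also have "\<dots> = (ratio ^ J - ratio ^ Suc n) / (1 - ratio)" using n ratio by (simp add: sum_gp)
      also have "\<dots> \<le> ratio ^ J / (1 - ratio)" using ratio by (intro divide_right_mono) auto
      finally show ?thesis unfolding sum_distrib_left[symmetric] using A' by (rule mult_left_mono)
    qed
    finally show ?thesis using eq J by linarith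
  qed
  then show "\<exists>\<epsilon>>0. \<exists>J. \<forall>n k. J \<le> n \<longrightarrow> b ^ J dvd k \<longrightarrow> \<epsilon> \<le> \<bar>scaled_incr n k f\<bar>"
    using nz by (intro exI[of _ "\<bar>slope f\<bar> / 4"] conjI exI[of _ J]) auto
qed

text \<open>If all slopes at the points \<open>b\<^sup>-\<^sup>m\<close> vanished, self-similarity would make \<open>fBm_cov H 1\<close> a
  geometric sequence along them, with ratio \<open>r\<close> satisfying \<open>r\<^sup>2 = b\<^sup>-\<^sup>2\<^sup>H\<close>; the first two terms
  already contradict strict subadditivity of \<open>x \<mapsto> x\<^sup>H\<close>.\<close>

lemma slope_fBm_cov_nonzero: "\<exists>t\<in>{0<..1}. slope (\<lambda>s. fBm_cov H s t) \<noteq> 0"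
proof (rule ccontr)
  assume "\<not> ?thesis"
  then have zero: "slope (\<lambda>s. fBm_cov H s (1 / real b ^ m)) = 0" for m
    using b by (auto simp: power_le_one_iff)
  define u where "u = 1 / real b"
  have u: "0 < u" "u < 1" using b by (auto simp: u_def)
  have pt: "1 / real b ^ m = u ^ m" for m by (simp add: u_def power_one_over)
  have um: "u ^ m \<in> {0..1}" for m using u by (simp add: power_le_one)
  define g where "g m = fBm_cov H 1 (u ^ m)" for m
  \<comment> \<open>The slope splits into a covariance part \<open>A m\<close> and a part
    \<open>c * g m\<close> in which \<kappa> enters only through the number
    \<open>c\<close>.\<close>
  define c where "c = (\<Sum>j. \<kappa> (u ^ Suc j) / \<alpha> ^ Suc j)"
  define A where "A m = (\<Sum>j. fBm_cov H (u ^ Suc j) (u ^ m) / \<alpha> ^ Suc j)" for m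
  have smK: "summable (\<lambda>j. \<kappa> (u ^ Suc j) / \<alpha> ^ Suc j)"
    unfolding pt[symmetric] by (rule holder_series_summable[OF kappa(1) kappa_holder])
  have smA: "summable (\<lambda>j. fBm_cov H (u ^ Suc j) (u ^ m) / \<alpha> ^ Suc j)" for m
    unfolding pt[symmetric]
  proof (rule holder_series_summable[where f="\<lambda>s. fBm_cov H s (1 / real b ^ m)"])
    show "fBm_cov H 0 (1 / real b ^ m) = 0" by (rule fBm_cov_0) simp
    show "\<bar>fBm_cov H s (1 / real b ^ m) - fBm_cov H t (1 / real b ^ m)\<bar> \<le> 2 * \<bar>s - t\<bar> powr H" if "s \<in> {0..1}" "t \<in> {0..1}" for s t
      using that H um unfolding pt by (intro fBm_cov_holder) auto
  qed
  have cg: "A m = c * g m" for m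
  proof -
    have "slope (\<lambda>s. fBm_cov H s (u ^ m)) = (\<Sum>j. fBm_cov H (u ^ Suc j) (u ^ m) / \<alpha> ^ Suc j - g m * (\<kappa> (u ^ Suc j) / \<alpha> ^ Suc j))"
      unfolding slope_def bridge_def pt g_def by (simp add: diff_divide_distrib algebra_simps)
    also have "\<dots> = A m - g m * c"
      unfolding A_def c_def by (subst suminf_diff[symmetric]) (intro smA summable_mult smK, intro smA summable_mult smK, simp only: suminf_mult[OF smK])
    finally show ?thesis using zero[of m] unfolding pt by simp
  qed
  define v where "v = u powr (2 * H)"
  \<comment> \<open>Self-similarity by the factor \<open>u\<close> shifts both indices by one; the
    first term of the series is left over and yields \<open>g m\<close>.\<close>
  have rec: "A (Suc m) = v / \<alpha> * (g m + A m)" for m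
  proof -
    have scale: "fBm_cov H (u ^ Suc j) (u ^ Suc m) = v * fBm_cov H (u ^ j) (u ^ m)" for j
      unfolding v_def power_Suc using u by (intro fBm_cov_scale) auto
    have "A (Suc m) = fBm_cov H (u ^ Suc 0) (u ^ Suc m) / \<alpha> ^ Suc 0 + (\<Sum>j. fBm_cov H (u ^ Suc (Suc j)) (u ^ Suc m) / \<alpha> ^ Suc (Suc j))"
      unfolding A_def using suminf_split_head[OF smA[of "Suc m"]] by simp
    also have "fBm_cov H (u ^ Suc 0) (u ^ Suc m) / \<alpha> ^ Suc 0 = v / \<alpha> * g m"
      unfolding scale g_def by simp
    also have "(\<Sum>j. fBm_cov H (u ^ Suc (Suc j)) (u ^ Suc m) / \<alpha> ^ Suc (Suc j)) = (\<Sum>j. v / \<alpha> * (fBm_cov H (u ^ Suc j) (u ^ m) / \<alpha> ^ Suc j))"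
      by (intro arg_cong[where f=suminf] ext, subst scale) simp
    also have "\<dots> = v / \<alpha> * A m" unfolding A_def by (rule suminf_mult[OF smA])
    finally show ?thesis by (simp add: algebra_simps)
  qed
  have v: "v > 0" using u by (simp add: v_def)
  have g0: "g 0 = 1" by (simp add: g_def fBm_cov_refl)
  have rec': "c * g (Suc m) = v / \<alpha> * ((1 + c) * g m)" for m
    using rec[of m] unfolding cg by (simp add: algebra_simps)
  have c0: "c \<noteq> 0"
  proof
    assume "c = 0"
    then show False using rec'[of 0] g0 v alpha by simp
  qed
  define r where "r = v * (1 + c) / (\<alpha> * c)"
  have gr: "g m = r ^ m" for m
  proof (induction m)
    case (Suc m)
    have "g (Suc m) = r * g m" using rec'[of m] c0 alpha by (simp add: r_def field_simps)
    then show ?case using Suc by simp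
  qed (simp add: g0)
  have ar: "fBm_cov H (u ^ Suc j) (u ^ 0) / \<alpha> ^ Suc j = (r / \<alpha>) ^ Suc j" for j
    using gr[of "Suc j"] by (simp add: g_def fBm_cov_commute[of H _ 1] power_divide)
  have smr: "summable (\<lambda>j. (r / \<alpha>) ^ Suc j)" using smA[of 0] unfolding ar .
  \<comment> \<open>For \<open>m = 0\<close> the relation \<open>cg\<close> shows that
    \<open>c\<close> itself is a geometric series in \<open>r / \<alpha>\<close>. This second
    equation between \<open>c\<close> and \<open>r\<close> allows \<open>c\<close> to be
    eliminated.\<close>
  have cr: "c = (\<Sum>j. (r / \<alpha>) ^ Suc j)" using cg[of 0] unfolding A_def ar by (simp add: g0)
  have "c = r / \<alpha> + (\<Sum>j. r / \<alpha> * (r / \<alpha>) ^ Suc j)"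
    using suminf_split_head[OF smr] unfolding cr by simp
  also have "(\<Sum>j. r / \<alpha> * (r / \<alpha>) ^ Suc j) = r / \<alpha> * c" unfolding cr by (rule suminf_mult[OF smr])
  finally have e1: "c * \<alpha> = r * (1 + c)" using alpha by (simp add: field_simps)
  have c1: "1 + c \<noteq> 0" using e1 c0 alpha by auto
  have e2: "r * (\<alpha> * c) = v * (1 + c)" using c0 alpha by (simp add: r_def)
  have "r * (r * (1 + c)) = v * (1 + c)" using e2 unfolding e1[symmetric] by (simp add: mult.commute)
  then have rr: "r * r = v" using c1 by simp
  define x where "x = u powr H"
  have x: "x > 0" "v = x * x" using u by (auto simp: x_def v_def simp flip: powr_add)
  define y where "y = (1 - u) powr H"
  have y: "y \<ge> 0" "y * y = (1 - u) powr (2 * H)" "y \<le> 1"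
    using u H by (auto simp: y_def powr_le1 simp flip: powr_add)
  \<comment> \<open>The explicit covariance between the points 1 and \<open>u\<close>; with
    \<open>v = r * r\<close> it becomes a perfect square.\<close>
  have "r = (1/2) * (1 + v - y * y)"
    using gr[of 1] u unfolding y(2) v_def by (simp add: g_def fBm_cov_def abs_minus_commute)
  then have "y * y = (1 - r) * (1 - r)" using rr by (simp add: algebra_simps)
  then have yr: "y = 1 - r \<or> y = r - 1" by (simp add: square_eq_iff)
  have "r = x \<or> r = - x" using rr x by (simp add: square_eq_iff)
  moreover have "x < 1" unfolding x_def using u H powr_less_mono2[of H u 1] by simp
  \<comment> \<open>The other sign choices would make \<open>y\<close> negative or larger than 1.
    What remains, \<open>u powr H + (1 - u) powr H = 1\<close>, fails because
    \<open>H < 1\<close>.\<close>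
  ultimately have "y = 1 - x" using yr x y by auto
  moreover have "x > u" unfolding x_def using powr_less_mono'[of u H 1] u H by simp
  moreover have "y \<ge> 1 - u" unfolding y_def using powr_mono'[of H 1 "1 - u"] u H by simp
  ultimately show False by simp
qed

end

section \<open>Fractional Brownian motion\<close>

locale fBm_space = prob_space M for M :: "'a measure" +
  fixes H :: real and W :: "real \<Rightarrow> 'a \<Rightarrow> real"
  assumes hurst: "0 < H" "H < 1" and fBm: "continuous_fBm M H W"
begin

lemma gaussian_lincomb:
  assumes "finite J" "J \<subseteq> {0..1}"
  shows "gaussian_rv M (\<lambda>\<omega>. \<Sum>t\<in>J. c t * W t \<omega>)"
  using fBm assms unfolding continuous_fBm_def gaussian_process_def by blast

lemma gaussian_W: "t \<in> {0..1} \<Longrightarrow> gaussian_rv M (W t)"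
  using gaussian_lincomb[of "{t}" "\<lambda>_. 1"] by simp

lemma measurable_W [measurable]: "t \<in> {0..1} \<Longrightarrow> W t \<in> borel_measurable M"
  using gaussian_W unfolding gaussian_rv_def by blast

lemma mean_W: "t \<in> {0..1} \<Longrightarrow> (\<integral>\<omega>. W t \<omega> \<partial>M) = 0"
  using fBm unfolding continuous_fBm_def by blast

lemma integrable_W_power: "t \<in> {0..1} \<Longrightarrow> integrable M (\<lambda>\<omega>. W t \<omega> ^ n)"
  by (rule gaussian_rv_moments(1)[OF prob_space_axioms gaussian_W mean_W])

lemma integrable_W: "t \<in> {0..1} \<Longrightarrow> integrable M (W t)"
  using integrable_W_power[of t 1] by simp

lemma integrable_W_times_W:
  assumes "s \<in> {0..1}" "t \<in> {0..1}"
  shows "integrable M (\<lambda>\<omega>. W s \<omega> * W t \<omega>)"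
proof (rule Bochner_Integration.integrable_bound)
  show "integrable M (\<lambda>\<omega>. W s \<omega> ^ 2 + W t \<omega> ^ 2)"
    using integrable_W_power assms by (intro Bochner_Integration.integrable_add)
  have "\<bar>x * y\<bar> \<le> x\<^sup>2 + y\<^sup>2" for x y :: real
  proof -
    have "2 * (\<bar>x\<bar> * \<bar>y\<bar>) \<le> \<bar>x\<bar>\<^sup>2 + \<bar>y\<bar>\<^sup>2" using sum_squares_bound[of "\<bar>x\<bar>" "\<bar>y\<bar>"] by simp
    moreover have "0 \<le> \<bar>x\<bar> * \<bar>y\<bar>" by simp
    ultimately show ?thesis by (simp only: abs_mult power2_abs)
  qed
  then show "AE \<omega> in M. norm (W s \<omega> * W t \<omega>) \<le> norm (W s \<omega> ^ 2 + W t \<omega> ^ 2)" by simp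
qed (use assms in measurable)

lemma cov_W:
  assumes "s \<in> {0..1}" "t \<in> {0..1}"
  shows "(\<integral>\<omega>. W s \<omega> * W t \<omega> \<partial>M) = fBm_cov H s t"
  using fBm assms unfolding continuous_fBm_def fBm_cov_def by blast

lemma mean_lincomb:
  assumes "finite J" "J \<subseteq> {0..1}"
  shows "(\<integral>\<omega>. (\<Sum>t\<in>J. c t * W t \<omega>) \<partial>M) = 0"
  using assms integrable_W mean_W
  by (subst Bochner_Integration.integral_sum) (auto intro!: sum.neutral)

lemmas lincomb_moments = gaussian_rv_moments[OF prob_space_axioms gaussian_lincomb mean_lincomb]

lemma cov_lincomb_W:
  assumes "finite J" "J \<subseteq> {0..1}" "s \<in> {0..1}"
  shows "(\<integral>\<omega>. (\<Sum>t\<in>J. c t * W t \<omega>) * W s \<omega> \<partial>M) = (\<Sum>t\<in>J. c t * fBm_cov H t s)"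
    and "integrable M (\<lambda>\<omega>. (\<Sum>t\<in>J. c t * W t \<omega>) * W s \<omega>)"
proof -
  have int: "integrable M (\<lambda>\<omega>. c t * (W t \<omega> * W s \<omega>))" if "t \<in> J" for t
    using assms that by (intro integrable_mult_right integrable_W_times_W) auto
  show "(\<integral>\<omega>. (\<Sum>t\<in>J. c t * W t \<omega>) * W s \<omega> \<partial>M) = (\<Sum>t\<in>J. c t * fBm_cov H t s)"
    unfolding sum_distrib_right mult.assoc
    by (subst Bochner_Integration.integral_sum[OF int]) (use assms in \<open>auto intro!: sum.cong simp: cov_W subset_iff\<close>)
  show "integrable M (\<lambda>\<omega>. (\<Sum>t\<in>J. c t * W t \<omega>) * W s \<omega>)"
    unfolding sum_distrib_right mult.assoc by (intro Bochner_Integration.integrable_sum int)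
qed

text \<open>The definition constrains \<open>W 0\<close> only through its moments, so it vanishes
  almost surely, by zero variance, and not necessarily everywhere. The formula in
  \<open>bridge_incr_cases\<close> requires this.\<close>

lemma W_0: "AE \<omega> in M. W 0 \<omega> = 0"
proof -
  have "(\<integral>\<omega>. W 0 \<omega> ^ 2 \<partial>M) = 0"
    using cov_W[of 0 0] by (simp add: power2_eq_square fBm_cov_0)
  then have "AE \<omega> in M. W 0 \<omega> ^ 2 = 0"
    using integral_nonneg_eq_0_iff_AE[OF integrable_W_power[of 0 2]] by simp
  then show ?thesis by simp
qed

lemma W_increment_moments:
  assumes "s \<in> {0..1}" "t \<in> {0..1}"
  shows "integrable M (\<lambda>\<omega>. (W t \<omega> - W s \<omega>) ^ (2 * k))"
    and "(\<integral>\<omega>. (W t \<omega> - W s \<omega>) ^ (2 * k) \<partial>M) = fact (2 * k) / (2 ^ k * fact k) * (\<bar>t - s\<bar> powr H) ^ (2 * k)"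
proof -
  \<comment> \<open>The difference of two indicators is correct also for \<open>s = t\<close>, where
    the index set collapses to one point.\<close>
  define c where "c r = (if r = t then 1 else 0) - (if r = s then 1 else 0 :: real)" for r
  have X: "(\<Sum>r\<in>{s, t}. c r * W r \<omega>) = W t \<omega> - W s \<omega>" for \<omega>
    by (cases "s = t") (auto simp: c_def)
  have J: "finite {s, t}" "{s, t} \<subseteq> {0..1}" using assms by auto
  show "integrable M (\<lambda>\<omega>. (W t \<omega> - W s \<omega>) ^ (2 * k))"
    using lincomb_moments(1)[OF J J, of c] unfolding X .
  have i: "integrable M (\<lambda>\<omega>. W t \<omega> * W t \<omega>)" "integrable M (\<lambda>\<omega>. 2 * (W s \<omega> * W t \<omega>))" "integrable M (\<lambda>\<omega>. W s \<omega> * W s \<omega>)"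
    using assms by (auto intro!: integrable_W_times_W integrable_mult_right)
  have "(\<integral>\<omega>. (W t \<omega> - W s \<omega>) ^ 2 \<partial>M) = (\<integral>\<omega>. W t \<omega> * W t \<omega> - 2 * (W s \<omega> * W t \<omega>) + W s \<omega> * W s \<omega> \<partial>M)"
    by (simp add: power2_eq_square algebra_simps)
  also have "\<dots> = fBm_cov H t t - 2 * fBm_cov H s t + fBm_cov H s s"
    using i assms by (simp add: cov_W)
  also have "\<dots> = (\<bar>t - s\<bar> powr H)\<^sup>2"
    by (simp add: fBm_cov_refl) (simp add: fBm_cov_def power2_eq_square field_simps flip: powr_add)
  finally have "(\<integral>\<omega>. (W t \<omega> - W s \<omega>) ^ 2 \<partial>M) = (\<bar>t - s\<bar> powr H)\<^sup>2" .
  then show "(\<integral>\<omega>. (W t \<omega> - W s \<omega>) ^ (2 * k) \<partial>M) = fact (2 * k) / (2 ^ k * fact k) * (\<bar>t - s\<bar> powr H) ^ (2 * k)"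
    using lincomb_moments(2)[OF J J, of c k] unfolding X by (simp add: power_mult)
qed

text \<open>Replacing the Gaussian variable \<open>W t\<^sub>0 / t\<^sub>0\<^sup>H\<close> in the orthogonal decomposition of \<open>W\<close> by
  an independent standard normal one does not change the law of the process.\<close>

definition resampled :: "real \<Rightarrow> real \<Rightarrow> 'a \<times> real \<Rightarrow> real" where
  "resampled t0 s p = fBm_cov H s t0 / t0 powr H * snd p
     + (W s (fst p) - fBm_cov H s t0 / t0 powr H * (W t0 (fst p) / t0 powr H))"

lemma measurable_resampled:
  assumes "s \<in> {0..1}" "t0 \<in> {0..1}"
  shows "resampled t0 s \<in> borel_measurable (M \<Otimes>\<^sub>M std_normal_distribution)"
proof -
  have [measurable]: "W s \<in> borel_measurable M" "W t0 \<in> borel_measurable M" using assms by measurable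
  show ?thesis unfolding resampled_def[abs_def] by measurable
qed

text \<open>Removing from a linear combination its projection on \<open>W t0\<close> lowers the
  variance by the square of \<open>a\<close>, and the independent term \<open>a * x\<close> restores
  it. Centered Gaussian variables with equal variance have the same characteristic function.\<close>

lemma resampled_char:
  assumes J: "finite J" "J \<subseteq> {0..1}" and t0: "t0 \<in> {0<..1}"
  shows "(CLINT p|M \<Otimes>\<^sub>M std_normal_distribution. iexp (\<Sum>s\<in>J. c s * resampled t0 s p))
     = (CLINT \<omega>|M. iexp (\<Sum>s\<in>J. c s * W s \<omega>))"
proof -
  interpret std: real_distribution std_normal_distribution by (rule real_dist_normal_dist)
  interpret P: pair_prob_space M std_normal_distribution ..
  define d where "d = t0 powr H"
  have d: "d > 0" "fBm_cov H t0 t0 = d * d" using t0 by (auto simp: d_def fBm_cov_refl simp flip: powr_add)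
  have t01: "t0 \<in> {0..1}" using t0 by auto
  \<comment> \<open>The covariance of the linear combination with the normalised variable
    \<open>W t0 / d\<close>.\<close>
  define a where "a = (\<Sum>s\<in>J. c s * fBm_cov H s t0) / d"
  define X where "X \<omega> = (\<Sum>s\<in>J. c s * W s \<omega>)" for \<omega>
  define X' where "X' \<omega> = X \<omega> - a / d * W t0 \<omega>" for \<omega>
  have sum_eq: "(\<Sum>s\<in>J. c s * resampled t0 s (\<omega>, x)) = X' \<omega> + x * a" for \<omega> x
  proof -
    have "(\<Sum>s\<in>J. c s * resampled t0 s (\<omega>, x))
      = (\<Sum>s\<in>J. c s * fBm_cov H s t0 * (x / d) + c s * W s \<omega> - c s * fBm_cov H s t0 * (W t0 \<omega> / d / d))"
      by (intro sum.cong refl) (simp add: resampled_def d_def algebra_simps)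
    also have "\<dots> = (\<Sum>s\<in>J. c s * fBm_cov H s t0) * (x / d) + X \<omega> - (\<Sum>s\<in>J. c s * fBm_cov H s t0) * (W t0 \<omega> / d / d)"
      by (simp only: sum.distrib sum_subtractf X_def sum_distrib_right)
    also have "\<dots> = X' \<omega> + x * a" unfolding X'_def a_def by simp
    finally show ?thesis .
  qed
  have sum_eq': "(\<Sum>s\<in>J. c s * resampled t0 s p) = X' (fst p) + snd p * a" for p
    using sum_eq[of "fst p" "snd p"] by simp
  define J' where "J' = insert t0 J"
  have J': "finite J'" "J' \<subseteq> {0..1}" using J t01 by (auto simp: J'_def)
  \<comment> \<open>The residual is again a linear combination of values of \<open>W\<close>, hence
    Gaussian; the formula covers \<open>t0\<close> inside and outside \<open>J\<close>.\<close>
  define c' where "c' s = (if s \<in> J then c s else 0) - (if s = t0 then a / d else 0)" for s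
  have X'_eq: "(\<Sum>s\<in>J'. c' s * W s \<omega>) = X' \<omega>" for \<omega>
  proof -
    have "(\<Sum>s\<in>J'. c' s * W s \<omega>) = (\<Sum>s\<in>J'. if s \<in> J then c s * W s \<omega> else 0) - (\<Sum>s\<in>J'. if s = t0 then a / d * W s \<omega> else 0)"
      unfolding sum_subtractf[symmetric] by (intro sum.cong) (auto simp: c'_def algebra_simps)
    also have "(\<Sum>s\<in>J'. if s \<in> J then c s * W s \<omega> else 0) = X \<omega>"
    proof -
      have "J' \<inter> J = J" by (auto simp: J'_def)
      then show ?thesis using J' by (simp add: X_def flip: sum.inter_restrict)
    qed
    also have "(\<Sum>s\<in>J'. if s = t0 then a / d * W s \<omega> else 0) = a / d * W t0 \<omega>"
      using J' by (simp add: J'_def)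
    finally show ?thesis unfolding X'_def .
  qed
  have [measurable]: "X' \<in> borel_measurable M"
    using gaussian_lincomb[OF J', of c'] unfolding X'_eq[abs_def] gaussian_rv_def by blast
  have Q: "(\<integral>\<omega>. X' \<omega> ^ 2 \<partial>M) = (\<integral>\<omega>. X \<omega> ^ 2 \<partial>M) - a\<^sup>2"
  proof -
    have i: "integrable M (\<lambda>\<omega>. X \<omega> ^ 2)" "integrable M (\<lambda>\<omega>. X \<omega> * W t0 \<omega>)" "integrable M (\<lambda>\<omega>. W t0 \<omega> * W t0 \<omega>)"
      using lincomb_moments(1)[OF J J, of c 2] cov_lincomb_W(2)[OF J t01, of c] integrable_W_times_W[OF t01 t01] unfolding X_def by auto
    have XW: "(\<integral>\<omega>. X \<omega> * W t0 \<omega> \<partial>M) = a * d"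
      using cov_lincomb_W(1)[OF J t01, of c] d(1) unfolding X_def a_def by simp
    have "(\<integral>\<omega>. X' \<omega> ^ 2 \<partial>M) = (\<integral>\<omega>. X \<omega> ^ 2 - 2 * (a / d) * (X \<omega> * W t0 \<omega>) + (a / d)\<^sup>2 * (W t0 \<omega> * W t0 \<omega>) \<partial>M)"
      unfolding X'_def by (intro Bochner_Integration.integral_cong refl) (simp add: power2_eq_square algebra_simps)
    also have "\<dots> = (\<integral>\<omega>. X \<omega> ^ 2 \<partial>M) - 2 * (a / d) * (a * d) + (a / d)\<^sup>2 * (d * d)"
      using i by (simp add: XW cov_W[OF t01 t01] d(2))
    also have "\<dots> = (\<integral>\<omega>. X \<omega> ^ 2 \<partial>M) - a\<^sup>2" using d(1) by (simp add: power2_eq_square field_simps)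
    finally show ?thesis .
  qed
  have int: "integrable (M \<Otimes>\<^sub>M std_normal_distribution) (\<lambda>p. iexp (X' (fst p) + snd p * a))"
    by (rule P.integrable_const_bound[where B=1]) auto
  have "(CLINT p|M \<Otimes>\<^sub>M std_normal_distribution. iexp (\<Sum>s\<in>J. c s * resampled t0 s p))
     = (CLINT p|M \<Otimes>\<^sub>M std_normal_distribution. iexp (X' (fst p) + snd p * a))"
    unfolding sum_eq' ..
  also have "\<dots> = (CLINT \<omega>|M. CLINT x|std_normal_distribution. iexp (X' \<omega> + x * a))"
    using P.integral_fst'[OF int] by simp
  also have "\<dots> = (CLINT \<omega>|M. CLINT x|std_normal_distribution. iexp (X' \<omega>) * iexp (a * x))"
    by (simp add: exp_add[symmetric] algebra_simps)
  also have "\<dots> = (CLINT \<omega>|M. iexp (X' \<omega>) * char std_normal_distribution a)"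
    unfolding char_def by (subst integral_mult_right_zero) (rule refl)
  also have "\<dots> = (CLINT \<omega>|M. iexp (X' \<omega>)) * char std_normal_distribution a" by simp
  also have "(CLINT \<omega>|M. iexp (X' \<omega>)) = of_real (exp (- (\<integral>\<omega>. X' \<omega> ^ 2 \<partial>M) / 2))"
    using lincomb_moments(3)[OF J' J', of c'] unfolding X'_eq .
  also have "\<dots> * char std_normal_distribution a = of_real (exp (- (\<integral>\<omega>. X' \<omega> ^ 2 \<partial>M) / 2 + - a\<^sup>2 / 2))"
    unfolding char_std_normal_distribution exp_add by simp
  also have "- (\<integral>\<omega>. X' \<omega> ^ 2 \<partial>M) / 2 + - a\<^sup>2 / 2 = - (\<integral>\<omega>. X \<omega> ^ 2 \<partial>M) / 2"
    unfolding Q by (simp add: field_simps)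
  also have "of_real (exp (- (\<integral>\<omega>. X \<omega> ^ 2 \<partial>M) / 2)) = (CLINT \<omega>|M. iexp (\<Sum>s\<in>J. c s * W s \<omega>))"
    using lincomb_moments(3)[OF J J, of c] unfolding X_def by simp
  finally show ?thesis .
qed

lemma resampled_law:
  assumes t0: "t0 \<in> {0<..1}"
  shows "distr M (PiM {0..1} (\<lambda>_. borel)) (\<lambda>\<omega>. \<lambda>s\<in>{0..1}. W s \<omega>)
    = distr (M \<Otimes>\<^sub>M std_normal_distribution) (PiM {0..1} (\<lambda>_. borel)) (\<lambda>p. \<lambda>s\<in>{0..1}. resampled t0 s p)"
proof (rule process_law_eqI)
  interpret std: real_distribution std_normal_distribution by (rule real_dist_normal_dist)
  interpret P: pair_prob_space M std_normal_distribution ..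
  show "prob_space (M \<Otimes>\<^sub>M std_normal_distribution)" by (rule P.prob_space_axioms)
  show "(CLINT \<omega>|M. iexp (\<Sum>i\<in>J. c i * W i \<omega>)) = (CLINT p|M \<Otimes>\<^sub>M std_normal_distribution. iexp (\<Sum>i\<in>J. c i * resampled t0 i p))"
    if "finite J" "J \<subseteq> {0..1}" for J c
    using resampled_char[OF that t0] by (rule sym)
qed (use t0 in \<open>auto intro: prob_space_axioms measurable_W measurable_resampled\<close>)

end

section \<open>Absolute continuity of the limit\<close>

locale weierstrass_fBm = weierstrass_bridge \<alpha> H C b \<kappa> + fBm_space M H W
  for \<alpha> H C :: real and b :: nat and \<kappa> :: "real \<Rightarrow> real" and M :: "'a measure" and W :: "real \<Rightarrow> 'a \<Rightarrow> real" +
  fixes q :: real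
  assumes q: "1 < q"
begin

definition power_mean :: "nat \<Rightarrow> (real \<Rightarrow> real) \<Rightarrow> real" where
  "power_mean n f = (\<Sum>k<b^n. \<bar>scaled_incr n k f\<bar> powr q) / real b ^ n"

text \<open>Fractional parts lie below 1, so only values on the unit interval enter. The means are
  therefore functions on the product space over \<open>{0..1}\<close>, where the laws are
  compared.\<close>

lemma scaled_incr_restrict: "scaled_incr n k (\<lambda>t\<in>{0..1}. f t) = scaled_incr n k f"
  by (simp add: scaled_incr_def bridge_incr_def bridge_def frac_lt_1 less_imp_le)

lemma power_mean_restrict: "power_mean n (\<lambda>t\<in>{0..1}. f t) = power_mean n f"
  by (simp only: power_mean_def scaled_incr_restrict)

lemma measurable_power_mean [measurable]:
  "power_mean n \<in> borel_measurable (PiM {0..1} (\<lambda>_. borel))"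
proof -
  have [measurable]: "(\<lambda>f. f t) \<in> borel_measurable (PiM {0..1} (\<lambda>_. borel))" if "t \<in> {0..1}" for t :: real
    using that by (rule measurable_component_singleton)
  have [measurable]: "bridge_incr j k \<in> borel_measurable (PiM {0..1} (\<lambda>_. borel))" for j k
    unfolding bridge_incr_def[abs_def] bridge_def
    by (intro borel_measurable_diff borel_measurable_times borel_measurable_const measurable_component_singleton)
       (auto simp: frac_lt_1 less_imp_le)
  show ?thesis
    unfolding power_mean_def[abs_def] scaled_incr_def by measurable
qed

lemma AE_std_normal_iff:
  "(AE x in std_normal_distribution. P x) \<longleftrightarrow> (AE x in lborel. P x)"
  by (subst AE_density) (auto simp: normal_density_pos)

text \<open>For frozen \<omega> the resampled increments are affine in \<open>x\<close>, with slopes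
  bounded away from 0 on the multiples of some \<open>b ^ J\<close>. The limit is then strictly
  convex on its conull domain, and strictly convex functions pull null sets back to null
  sets.\<close>

lemma limit_avoids_null_set:
  assumes N0: "N0 \<in> null_sets lborel" and t0: "t0 \<in> {0<..1}" and slope: "slope (\<lambda>s. fBm_cov H s t0) \<noteq> 0"
    and conv: "AE x in lborel. convergent (\<lambda>n. power_mean n (\<lambda>s. resampled t0 s (\<omega>, x)))"
  shows "AE x in lborel. \<not> (convergent (\<lambda>n. power_mean n (\<lambda>s. resampled t0 s (\<omega>, x)))
      \<and> lim (\<lambda>n. power_mean n (\<lambda>s. resampled t0 s (\<omega>, x))) \<in> N0)"
proof -
  define d where "d = t0 powr H"
  have d: "d > 0" using t0 by (auto simp: d_def)
  define w where "w s = W s \<omega> - fBm_cov H s t0 / d * (W t0 \<omega> / d)" for s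
  define a where "a n k = scaled_incr n k (\<lambda>s. fBm_cov H s t0) / d" for n k
  have incr: "scaled_incr n k (\<lambda>s. resampled t0 s (\<omega>, x)) = a n k * x + scaled_incr n k w" for n k x
  proof -
    have "(\<lambda>s. resampled t0 s (\<omega>, x)) = (\<lambda>s. fBm_cov H s t0 * (x / d) + w s)"
      by (auto simp: resampled_def d_def w_def)
    then show ?thesis by (simp only: scaled_incr_affine a_def) simp
  qed
  have "\<exists>\<epsilon>>0. \<exists>J. \<forall>n k. J \<le> n \<longrightarrow> b ^ J dvd k \<longrightarrow> \<epsilon> \<le> \<bar>scaled_incr n k (\<lambda>s. fBm_cov H s t0)\<bar>"
  proof (rule scaled_incr_lower[OF _ _ slope])
    show "fBm_cov H 0 t0 = 0" using t0 by (intro fBm_cov_0) auto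
    show "\<bar>fBm_cov H s t0 - fBm_cov H t t0\<bar> \<le> 2 * \<bar>s - t\<bar> powr H" if "s \<in> {0..1}" "t \<in> {0..1}" for s t
      using that H t0 by (intro fBm_cov_holder) auto
  qed
  then obtain \<epsilon> J where eJ: "\<epsilon> > 0" "\<And>n k. J \<le> n \<Longrightarrow> b ^ J dvd k \<Longrightarrow> \<epsilon> \<le> \<bar>scaled_incr n k (\<lambda>s. fBm_cov H s t0)\<bar>"
    by blast
  have slopes: "\<epsilon> / d \<le> \<bar>a n k\<bar>" if "J \<le> n" "b ^ J dvd k" for n k
    using eJ(2)[OF that] d by (simp add: a_def divide_right_mono)
  define h where "h n x = power_mean n (\<lambda>s. resampled t0 s (\<omega>, x))" for n x
  have h: "h n x = (\<Sum>k<b^n. \<bar>a n k * x + scaled_incr n k w\<bar> powr q) / real b ^ n" for n x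
    unfolding h_def power_mean_def incr ..
  define S where "S = {x. convergent (\<lambda>n. h n x)}"
  define v where "v x = lim (\<lambda>n. h n x)" for x
  have "negligible {x \<in> S. v x \<in> N0}"
  proof (rule strictly_convex_vimage_negligible)
    \<comment> \<open>Negligible sets are the null sets of the completed measure, so the argument
      moves from \<open>lborel\<close> to \<open>lebesgue\<close> and back at the end.\<close>
    have "AE x in lebesgue. x \<in> S"
      using conv unfolding AE_completion_iff S_def h_def by simp
    then obtain N' where "N' \<in> null_sets lebesgue" "{x \<in> space lebesgue. x \<notin> S} \<subseteq> N'"
      unfolding eventually_ae_filter by blast
    then show "negligible (- S)"
      using negligible_subset[of N' "- S"] unfolding negligible_iff_null_sets[symmetric] by auto
    show "negligible N0" unfolding negligible_iff_null_sets by (rule null_sets_completionI[OF N0])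
    fix x y z assume xyz: "x \<in> S" "y \<in> S" "z \<in> S" "x < y" "y < z"
    have lim: "(\<lambda>n. h n x) \<longlonglongrightarrow> v x" if "x \<in> S" for x
      using that unfolding S_def v_def by (simp add: convergent_LIMSEQ_iff)
    show "(v y - v x) / (y - x) < (v z - v y) / (z - y)"
      by (rule limit_of_powr_averages_strictly_convex[OF q _ _ slopes, where w="\<lambda>n k. scaled_incr n k w"])
         (use xyz b eJ(1) d lim in \<open>auto simp: h[symmetric]\<close>)
  qed
  then have "{x \<in> S. v x \<in> N0} \<in> null_sets lebesgue" unfolding negligible_iff_null_sets .
  then have "AE x in lebesgue. x \<notin> {x \<in> S. v x \<in> N0}" by (rule AE_not_in)
  then show ?thesis unfolding AE_completion_iff by (simp add: S_def v_def h_def)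
qed

text \<open>Convergence is carried from \<open>M\<close> to the product space, the null set is
  avoided there for almost every \<omega> in almost every \<open>x\<close>, and Fubini together with
  equality of laws carries this back.\<close>

theorem limit_law_absolutely_continuous:
  assumes [measurable]: "V \<in> borel_measurable M"
    and lim: "AE \<omega> in M. (\<lambda>n. power_mean n (\<lambda>s. W s \<omega>)) \<longlonglongrightarrow> V \<omega>"
  shows "absolutely_continuous lborel (distr M borel V)"
  unfolding absolutely_continuous_def
proof
  interpret std: real_distribution std_normal_distribution by (rule real_dist_normal_dist)
  interpret P: pair_prob_space M std_normal_distribution ..
  fix N0 :: "real set" assume N0: "N0 \<in> null_sets lborel"
  then have [measurable]: "N0 \<in> sets borel" by auto
  obtain t0 where t0: "t0 \<in> {0<..1}" "slope (\<lambda>s. fBm_cov H s t0) \<noteq> 0"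
    using slope_fBm_cov_nonzero by blast
  let ?P = "PiM {0..1} (\<lambda>_. borel) :: (real \<Rightarrow> real) measure"
  let ?W = "\<lambda>\<omega>. \<lambda>s\<in>{0..1}. W s \<omega>"
  let ?Z = "\<lambda>p. \<lambda>s\<in>{0..1}. resampled t0 s p"
  have mW: "?W \<in> measurable M ?P" by (rule measurable_restrict) (rule measurable_W)
  have mZ: "?Z \<in> measurable (M \<Otimes>\<^sub>M std_normal_distribution) ?P"
    by (rule measurable_restrict) (use t0 in \<open>auto intro: measurable_resampled\<close>)
  have transfer: "(AE \<omega> in M. Q (?W \<omega>)) \<longleftrightarrow> (AE p in M \<Otimes>\<^sub>M std_normal_distribution. Q (?Z p))"
    if "{f \<in> space ?P. Q f} \<in> sets ?P" for Q
  proof -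
    have "(AE \<omega> in M. Q (?W \<omega>)) \<longleftrightarrow> (AE f in distr M ?P ?W. Q f)"
      by (rule AE_distr_iff[OF mW that, symmetric])
    also have "\<dots> \<longleftrightarrow> (AE f in distr (M \<Otimes>\<^sub>M std_normal_distribution) ?P ?Z. Q f)"
      unfolding resampled_law[OF t0(1)] ..
    also have "\<dots> \<longleftrightarrow> (AE p in M \<Otimes>\<^sub>M std_normal_distribution. Q (?Z p))"
      by (rule AE_distr_iff[OF mZ that])
    finally show ?thesis .
  qed
  have mC: "{f \<in> space ?P. convergent (\<lambda>n. power_mean n f)} \<in> sets ?P"
    unfolding Cauchy_convergent_iff[symmetric] by measurable
  then have [measurable]: "Measurable.pred ?P (\<lambda>f. convergent (\<lambda>n. power_mean n f))" by (simp add: pred_def)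
  \<comment> \<open>The event is expressed by \<open>lim\<close> of the path functional, since
    \<open>V\<close> is given on \<open>M\<close> only and has no counterpart on the product
    space.\<close>
  have mE: "{f \<in> space ?P. \<not> (convergent (\<lambda>n. power_mean n f) \<and> lim (\<lambda>n. power_mean n f) \<in> N0)} \<in> sets ?P"
    by measurable
  have "{p \<in> space (M \<Otimes>\<^sub>M std_normal_distribution). \<not> (convergent (\<lambda>n. power_mean n (?Z p)) \<and> lim (\<lambda>n. power_mean n (?Z p)) \<in> N0)}
    = ?Z -` {f \<in> space ?P. \<not> (convergent (\<lambda>n. power_mean n f) \<and> lim (\<lambda>n. power_mean n f) \<in> N0)} \<inter> space (M \<Otimes>\<^sub>M std_normal_distribution)"
    using measurable_space[OF mZ] by blast
  with measurable_sets[OF mZ mE]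
  have mEZ: "{p \<in> space (M \<Otimes>\<^sub>M std_normal_distribution). \<not> (convergent (\<lambda>n. power_mean n (?Z p)) \<and> lim (\<lambda>n. power_mean n (?Z p)) \<in> N0)}
    \<in> sets (M \<Otimes>\<^sub>M std_normal_distribution)"
    by (simp only:)
  have "AE \<omega> in M. convergent (\<lambda>n. power_mean n (?W \<omega>))"
    using lim unfolding power_mean_restrict by eventually_elim (auto simp: convergent_def)
  then have "AE p in M \<Otimes>\<^sub>M std_normal_distribution. convergent (\<lambda>n. power_mean n (?Z p))"
    unfolding transfer[OF mC] .
  then have "AE \<omega> in M. AE x in std_normal_distribution. convergent (\<lambda>n. power_mean n (?Z (\<omega>, x)))"
    by (rule P.AE_pair)
  then have "AE \<omega> in M. AE x in std_normal_distribution.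
    \<not> (convergent (\<lambda>n. power_mean n (?Z (\<omega>, x))) \<and> lim (\<lambda>n. power_mean n (?Z (\<omega>, x))) \<in> N0)"
    unfolding power_mean_restrict AE_std_normal_iff
    by eventually_elim (rule limit_avoids_null_set[OF N0 t0])
  then have "AE p in M \<Otimes>\<^sub>M std_normal_distribution.
    \<not> (convergent (\<lambda>n. power_mean n (?Z p)) \<and> lim (\<lambda>n. power_mean n (?Z p)) \<in> N0)"
    by (rule P.AE_pair_measure[OF mEZ])
  then have "AE \<omega> in M. \<not> (convergent (\<lambda>n. power_mean n (?W \<omega>)) \<and> lim (\<lambda>n. power_mean n (?W \<omega>)) \<in> N0)"
    unfolding transfer[OF mE] .
  then have "AE \<omega> in M. V \<omega> \<notin> N0"
    using lim unfolding power_mean_restrict by eventually_elim (auto simp: convergent_def limI)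
  then have "AE x in distr M borel V. x \<notin> N0"
    by (subst AE_distr_iff) auto
  then show "N0 \<in> null_sets (distr M borel V)"
    by (subst (asm) AE_iff_null_sets[symmetric]) auto
qed

end

section \<open>Moments of the limit\<close>

text \<open>Jensen's inequality for an even power with weights that need not sum to 1; normalising
  them produces the factor with exponent \<open>2 * m - 1\<close>.\<close>

lemma even_power_sum_le:
  fixes w x :: "'i \<Rightarrow> real"
  assumes "finite I" and w: "\<And>i. i \<in> I \<Longrightarrow> 0 \<le> w i" and "1 \<le> m"
  shows "(\<Sum>i\<in>I. w i * x i) ^ (2 * m) \<le> (\<Sum>i\<in>I. w i) ^ (2 * m - 1) * (\<Sum>i\<in>I. w i * x i ^ (2 * m))"
proof (cases "(\<Sum>i\<in>I. w i) = 0")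
  case True
  then have "w i = 0" if "i \<in> I" for i using sum_nonneg_eq_0_iff[OF assms(1) w] that by auto
  then show ?thesis using assms(3) by (simp add: power_0_left)
next
  case False
  define s where "s = (\<Sum>i\<in>I. w i)"
  have s: "s > 0" using False sum_nonneg[of I w] w by (simp add: s_def less_le)
  have "(\<Sum>i\<in>I. (w i / s) *\<^sub>R x i) ^ (2 * m) \<le> (\<Sum>i\<in>I. (w i / s) * x i ^ (2 * m))"
  proof (rule convex_on_sum[where C=UNIV])
    show "convex_on UNIV (\<lambda>x::real. x ^ (2 * m))" by (rule convex_power_even) simp
    show "(\<Sum>i\<in>I. w i / s) = 1" using s by (simp add: s_def flip: sum_divide_distrib)
    show "I \<noteq> {}" using False by auto
  qed (use assms s in auto)
  then have "((\<Sum>i\<in>I. w i * x i) / s) ^ (2 * m) \<le> (\<Sum>i\<in>I. w i * x i ^ (2 * m)) / s"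
    by (simp add: sum_divide_distrib)
  then have "(\<Sum>i\<in>I. w i * x i) ^ (2 * m) \<le> (\<Sum>i\<in>I. w i * x i ^ (2 * m)) / s * s ^ (2 * m)"
    using s by (simp add: power_divide divide_le_eq)
  also have "s ^ (2 * m) = s * s ^ (2 * m - 1)" using assms(3) by (cases m) auto
  also have "(\<Sum>i\<in>I. w i * x i ^ (2 * m)) / s * (s * s ^ (2 * m - 1)) = s ^ (2 * m - 1) * (\<Sum>i\<in>I. w i * x i ^ (2 * m))"
    using s by simp
  finally show ?thesis unfolding s_def .
qed

lemma even_power_add_le:
  fixes x y :: real
  assumes "1 \<le> m"
  shows "(x + y) ^ (2 * m) \<le> 2 ^ (2 * m - 1) * (x ^ (2 * m) + y ^ (2 * m))"
  using even_power_sum_le[of "{True, False}" "\<lambda>_. 1" m "\<lambda>i. if i then x else y"] assms by simp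

text \<open>Real exponents are traded for even integer ones, for which Gaussian moments are
  explicit.\<close>

lemma powr_le_one_plus_even_power:
  fixes x p :: real
  assumes "0 \<le> p" "p \<le> 2 * real R"
  shows "\<bar>x\<bar> powr p \<le> 1 + x ^ (2 * R)"
proof (cases "\<bar>x\<bar> \<le> 1")
  case True
  then have "\<bar>x\<bar> powr p \<le> 1" using assms by (intro powr_le1) auto
  moreover have "0 \<le> x ^ (2 * R)" by (rule zero_le_even_power) simp
  ultimately show ?thesis by linarith
next
  case False
  then have "\<bar>x\<bar> powr p \<le> \<bar>x\<bar> powr real (2 * R)" using assms by (intro powr_mono) auto
  also have "\<dots> = \<bar>x\<bar> ^ (2 * R)" using False by (intro powr_realpow) auto
  also have "\<dots> = x ^ (2 * R)" by (simp add: power_even_abs)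
  finally show ?thesis by simp
qed

context weierstrass_fBm
begin

lemma measurable_bridge_incr_W [measurable]:
  "(\<lambda>\<omega>. bridge_incr j k (\<lambda>s. W s \<omega>)) \<in> borel_measurable M"
  unfolding bridge_incr_def bridge_def
  by (intro borel_measurable_diff borel_measurable_times borel_measurable_const measurable_W)
     (auto simp: frac_lt_1 less_imp_le)

lemma measurable_scaled_incr_W [measurable]:
  "(\<lambda>\<omega>. scaled_incr n k (\<lambda>s. W s \<omega>)) \<in> borel_measurable M"
  unfolding scaled_incr_def by measurable

lemma measurable_power_mean_W [measurable]:
  "(\<lambda>\<omega>. power_mean n (\<lambda>s. W s \<omega>)) \<in> borel_measurable M"
  unfolding power_mean_def by measurable

lemma integrable_integral_le:
  fixes f g :: "'a \<Rightarrow> real"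
  assumes "f \<in> borel_measurable M" "integrable M g" "AE \<omega> in M. 0 \<le> f \<omega> \<and> f \<omega> \<le> g \<omega>" "(\<integral>\<omega>. g \<omega> \<partial>M) \<le> D"
  shows "integrable M f \<and> (\<integral>\<omega>. f \<omega> \<partial>M) \<le> D"
proof
  show "integrable M f"
    by (rule Bochner_Integration.integrable_bound[OF assms(2,1)]) (use assms(3) in eventually_elim, auto)
  then have "(\<integral>\<omega>. f \<omega> \<partial>M) \<le> (\<integral>\<omega>. g \<omega> \<partial>M)"
    by (rule integral_mono_AE[OF _ assms(2)]) (use assms(3) in eventually_elim, auto)
  then show "(\<integral>\<omega>. f \<omega> \<partial>M) \<le> D" using assms(4) by simp
qed

text \<open>Divided by the mesh to the power \<open>H\<close>, an increment of \<open>W\<close> is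
  Gaussian with variance 1, and the increment of \<kappa> is at most \<open>C\<close>. So the bound
  is independent of \<open>j\<close> and \<open>k\<close>.\<close>

lemma bridge_incr_moment:
  assumes m: "1 \<le> m"
  shows "\<exists>D. \<forall>j k. integrable M (\<lambda>\<omega>. (bridge_incr j k (\<lambda>s. W s \<omega>) / (real b powr (- H)) ^ j) ^ (2 * m))
    \<and> (\<integral>\<omega>. (bridge_incr j k (\<lambda>s. W s \<omega>) / (real b powr (- H)) ^ j) ^ (2 * m) \<partial>M) \<le> D"
proof -
  \<comment> \<open>The moment of order \<open>2 * m\<close> of the standard normal law.\<close>
  define c :: real where "c = fact (2 * m) / (2 ^ m * fact m)"
  have W1: "(\<integral>\<omega>. W 1 \<omega> ^ (2 * m) \<partial>M) = c"
  proof -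
    have "(\<integral>\<omega>. W 1 \<omega> ^ 2 \<partial>M) = 1" using cov_W[of 1 1] by (simp add: power2_eq_square fBm_cov_refl)
    then show ?thesis
      using gaussian_rv_moments(2)[OF prob_space_axioms gaussian_W mean_W, of 1 m] by (simp add: c_def)
  qed
  have "integrable M (\<lambda>\<omega>. (bridge_incr j k (\<lambda>s. W s \<omega>) / (real b powr (- H)) ^ j) ^ (2 * m))
    \<and> (\<integral>\<omega>. (bridge_incr j k (\<lambda>s. W s \<omega>) / (real b powr (- H)) ^ j) ^ (2 * m) \<partial>M) \<le> 2 ^ (2 * m - 1) * (c + C ^ (2 * m) * c)" for j k
  proof -
    obtain s t where st: "s \<in> {0..1}" "t \<in> {0..1}" "t - s = 1 / real b ^ j"
      "\<And>f. f 0 = 0 \<Longrightarrow> bridge_incr j k f = f t - f s - (\<kappa> t - \<kappa> s) * f 1"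
      using bridge_incr_cases[of j k] by metis
    define \<delta> where "\<delta> = (real b powr (- H)) ^ j"
    have \<delta>: "\<delta> > 0" "\<bar>t - s\<bar> powr H = \<delta>" using b unfolding st(3) \<delta>_def mesh_powr[symmetric] by auto
    define g where "g \<omega> = 2 ^ (2 * m - 1) * ((W t \<omega> - W s \<omega>) ^ (2 * m) / \<delta> ^ (2 * m) + C ^ (2 * m) * W 1 \<omega> ^ (2 * m))" for \<omega>
    have i: "integrable M (\<lambda>\<omega>. (W t \<omega> - W s \<omega>) ^ (2 * m) / \<delta> ^ (2 * m))" "integrable M (\<lambda>\<omega>. C ^ (2 * m) * W 1 \<omega> ^ (2 * m))"
      using W_increment_moments(1)[OF st(1,2)] integrable_W_power[of 1] by auto
    have i1: "integrable M (\<lambda>\<omega>. W 1 \<omega> ^ (2 * m))" by (rule integrable_W_power) simp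
    have intg: "integrable M g" unfolding g_def using i i1 by (intro integrable_mult_right Bochner_Integration.integrable_add)
    have "(\<integral>\<omega>. g \<omega> \<partial>M) = 2 ^ (2 * m - 1) * ((\<integral>\<omega>. (W t \<omega> - W s \<omega>) ^ (2 * m) \<partial>M) / \<delta> ^ (2 * m) + C ^ (2 * m) * (\<integral>\<omega>. W 1 \<omega> ^ (2 * m) \<partial>M))"
      unfolding g_def integral_mult_right_zero Bochner_Integration.integral_add[OF i]
      by (simp add: i1)
    also have "\<dots> = 2 ^ (2 * m - 1) * (c + C ^ (2 * m) * c)"
      unfolding W_increment_moments(2)[OF st(1,2)] W1 \<delta>(2) c_def using \<delta>(1) by simp
    finally have ig: "(\<integral>\<omega>. g \<omega> \<partial>M) \<le> 2 ^ (2 * m - 1) * (c + C ^ (2 * m) * c)" by simp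
    show ?thesis unfolding \<delta>_def[symmetric]
    proof (rule integrable_integral_le[OF _ intg _ ig])
      show "AE \<omega> in M. 0 \<le> (bridge_incr j k (\<lambda>s. W s \<omega>) / \<delta>) ^ (2 * m) \<and> (bridge_incr j k (\<lambda>s. W s \<omega>) / \<delta>) ^ (2 * m) \<le> g \<omega>"
        using W_0
      proof eventually_elim
        case (elim \<omega>)
        have incr: "bridge_incr j k (\<lambda>s. W s \<omega>) = W t \<omega> - W s \<omega> - (\<kappa> t - \<kappa> s) * W 1 \<omega>"
          by (rule st(4)) (rule elim)
        have "bridge_incr j k (\<lambda>s. W s \<omega>) / \<delta> = (W t \<omega> - W s \<omega>) / \<delta> + (- (\<kappa> t - \<kappa> s) / \<delta>) * W 1 \<omega>"
          unfolding incr by (simp add: diff_divide_distrib add_divide_distrib algebra_simps)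
        then have "(bridge_incr j k (\<lambda>s. W s \<omega>) / \<delta>) ^ (2 * m) \<le> 2 ^ (2 * m - 1) * (((W t \<omega> - W s \<omega>) / \<delta>) ^ (2 * m) + ((- (\<kappa> t - \<kappa> s) / \<delta>) * W 1 \<omega>) ^ (2 * m))"
          using even_power_add_le[OF m] by simp
        also have "((- (\<kappa> t - \<kappa> s) / \<delta>) * W 1 \<omega>) ^ (2 * m) \<le> C ^ (2 * m) * W 1 \<omega> ^ (2 * m)"
        proof -
          have "\<bar>- (\<kappa> t - \<kappa> s) / \<delta>\<bar> \<le> C"
            using kappa_holder[OF st(2,1)] \<delta> by (simp add: divide_le_eq abs_minus_commute)
          then have "\<bar>- (\<kappa> t - \<kappa> s) / \<delta>\<bar> ^ (2 * m) \<le> C ^ (2 * m)" by (intro power_mono) auto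
          then have "(- (\<kappa> t - \<kappa> s) / \<delta>) ^ (2 * m) \<le> C ^ (2 * m)" by (simp only: power_even_abs even_mult_iff even_numeral simp_thms)
          then show ?thesis unfolding power_mult_distrib by (intro mult_right_mono) auto
        qed
        finally show ?case unfolding g_def by (simp add: power_divide)
      qed
    qed measurable
  qed
  then show ?thesis by blast
qed

text \<open>Jensen's inequality with the weights \<open>ratio ^ j\<close> on the normalised
  increments; the sum of the weights is at most \<open>1 / (1 - ratio)\<close> for every
  \<open>n\<close>.\<close>

lemma scaled_incr_moment:
  assumes m: "1 \<le> m"
  shows "\<exists>D. \<forall>n k. integrable M (\<lambda>\<omega>. scaled_incr n k (\<lambda>s. W s \<omega>) ^ (2 * m))
    \<and> (\<integral>\<omega>. scaled_incr n k (\<lambda>s. W s \<omega>) ^ (2 * m) \<partial>M) \<le> D"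
proof -
  define y where "y j k \<omega> = bridge_incr j k (\<lambda>s. W s \<omega>) / (real b powr (- H)) ^ j" for j k \<omega>
  obtain D where D: "\<And>j k. integrable M (\<lambda>\<omega>. y j k \<omega> ^ (2 * m))" "\<And>j k. (\<integral>\<omega>. y j k \<omega> ^ (2 * m) \<partial>M) \<le> D"
    using bridge_incr_moment[OF m] unfolding y_def by blast
  have "0 \<le> (\<integral>\<omega>. y 0 0 \<omega> ^ (2 * m) \<partial>M)" by simp
  then have D0: "0 \<le> D" using D(2)[of 0 0] by linarith
  define T where "T = 1 / (1 - ratio)"
  have T: "T \<ge> 0" using ratio by (simp add: T_def)
  have "integrable M (\<lambda>\<omega>. scaled_incr n k (\<lambda>s. W s \<omega>) ^ (2 * m))
    \<and> (\<integral>\<omega>. scaled_incr n k (\<lambda>s. W s \<omega>) ^ (2 * m) \<partial>M) \<le> T ^ (2 * m - 1) * (T * D)" for n k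
  proof -
    define S where "S = (\<Sum>j=1..n. ratio ^ j)"
    have "S \<le> (\<Sum>j=0..n. ratio ^ j)" unfolding S_def using ratio by (intro sum_mono2) auto
    also have "\<dots> = (1 - ratio ^ Suc n) / (1 - ratio)" using ratio by (simp add: sum_gp)
    also have "\<dots> \<le> T" unfolding T_def using ratio by (intro divide_right_mono) auto
    finally have ST: "S \<le> T" .
    have S: "0 \<le> S" unfolding S_def using ratio by (intro sum_nonneg) auto
    have eq: "scaled_incr n k (\<lambda>s. W s \<omega>) = (\<Sum>j=1..n. ratio ^ j * y j k \<omega>)" for \<omega>
      unfolding scaled_incr_def y_def ratio_def using b alpha
      by (intro sum.cong refl) (simp add: power_divide)
    define g where "g \<omega> = S ^ (2 * m - 1) * (\<Sum>j=1..n. ratio ^ j * y j k \<omega> ^ (2 * m))" for \<omega>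
    have intg: "integrable M g" unfolding g_def
      by (intro integrable_mult_right Bochner_Integration.integrable_sum D)
    have "(\<integral>\<omega>. g \<omega> \<partial>M) = S ^ (2 * m - 1) * (\<Sum>j=1..n. ratio ^ j * (\<integral>\<omega>. y j k \<omega> ^ (2 * m) \<partial>M))"
      unfolding g_def integral_mult_right_zero
      by (subst Bochner_Integration.integral_sum) (auto intro!: integrable_mult_right D)
    also have "\<dots> \<le> S ^ (2 * m - 1) * (\<Sum>j=1..n. ratio ^ j * D)"
      using S ratio by (intro mult_left_mono sum_mono D) auto
    also have "\<dots> = S ^ (2 * m - 1) * (S * D)" by (simp add: S_def sum_distrib_right)
    also have "\<dots> \<le> T ^ (2 * m - 1) * (T * D)"
      using S T ST D0 by (intro mult_mono power_mono mult_right_mono) auto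
    finally have ig: "(\<integral>\<omega>. g \<omega> \<partial>M) \<le> T ^ (2 * m - 1) * (T * D)" .
    show ?thesis
    proof (rule integrable_integral_le[OF _ intg _ ig])
      have "scaled_incr n k (\<lambda>s. W s \<omega>) ^ (2 * m) \<le> g \<omega>" for \<omega>
        unfolding eq g_def S_def using ratio m by (intro even_power_sum_le) auto
      then show "AE \<omega> in M. 0 \<le> scaled_incr n k (\<lambda>s. W s \<omega>) ^ (2 * m) \<and> scaled_incr n k (\<lambda>s. W s \<omega>) ^ (2 * m) \<le> g \<omega>"
        by simp
    qed measurable
  qed
  then show ?thesis by blast
qed

lemma power_mean_moment:
  assumes m: "1 \<le> m"
  shows "\<exists>D. \<forall>n. integrable M (\<lambda>\<omega>. power_mean n (\<lambda>s. W s \<omega>) ^ (2 * m))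
    \<and> (\<integral>\<omega>. power_mean n (\<lambda>s. W s \<omega>) ^ (2 * m) \<partial>M) \<le> D"
proof -
  \<comment> \<open>Large enough that
    \<open>(\<bar>x\<bar> powr q) ^ (2 * m) \<le> 1 + x ^ (2 * R)\<close>, although \<open>q\<close>
    need not be an integer.\<close>
  define R where "R = nat \<lceil>real m * q\<rceil>"
  have R: "real m * q \<le> real R" unfolding R_def by (rule real_nat_ceiling_ge)
  have "real R > 0" using R q m by (intro less_le_trans[OF _ R] mult_pos_pos) auto
  then have "1 \<le> R" by simp
  then obtain D where D: "\<And>n k. integrable M (\<lambda>\<omega>. scaled_incr n k (\<lambda>s. W s \<omega>) ^ (2 * R))"
    "\<And>n k. (\<integral>\<omega>. scaled_incr n k (\<lambda>s. W s \<omega>) ^ (2 * R) \<partial>M) \<le> D"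
    using scaled_incr_moment by blast
  have "integrable M (\<lambda>\<omega>. power_mean n (\<lambda>s. W s \<omega>) ^ (2 * m))
    \<and> (\<integral>\<omega>. power_mean n (\<lambda>s. W s \<omega>) ^ (2 * m) \<partial>M) \<le> 1 + D" for n
  proof -
    define g where "g \<omega> = (\<Sum>k<b^n. 1 / real b ^ n * (1 + scaled_incr n k (\<lambda>s. W s \<omega>) ^ (2 * R)))" for \<omega>
    have bn: "real b ^ n > 0" using b by simp
    have i: "integrable M (\<lambda>\<omega>. 1 + scaled_incr n k (\<lambda>s. W s \<omega>) ^ (2 * R))" for k
      by (intro Bochner_Integration.integrable_add D) simp
    have intg: "integrable M g" unfolding g_def
      by (intro integrable_mult_right Bochner_Integration.integrable_sum i)
    have "(\<integral>\<omega>. g \<omega> \<partial>M) = (\<Sum>k<b^n. 1 / real b ^ n * (\<integral>\<omega>. 1 + scaled_incr n k (\<lambda>s. W s \<omega>) ^ (2 * R) \<partial>M))"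
      unfolding g_def by (subst Bochner_Integration.integral_sum) (auto intro!: integrable_mult_right i simp del: integrable_divide_zero)
    also have "\<dots> = (\<Sum>k<b^n. 1 / real b ^ n * (1 + (\<integral>\<omega>. scaled_incr n k (\<lambda>s. W s \<omega>) ^ (2 * R) \<partial>M)))"
      by (subst Bochner_Integration.integral_add) (auto intro: D simp: prob_space)
    also have "\<dots> \<le> (\<Sum>k<b^n. 1 / real b ^ n * (1 + D))"
      using bn by (intro sum_mono mult_left_mono add_left_mono D) auto
    also have "\<dots> = 1 + D" using b by simp
    finally have ig: "(\<integral>\<omega>. g \<omega> \<partial>M) \<le> 1 + D" .
    show ?thesis
    proof (rule integrable_integral_le[OF _ intg _ ig])
      have "power_mean n (\<lambda>s. W s \<omega>) ^ (2 * m) \<le> g \<omega>" for \<omega>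
      proof -
        have "power_mean n (\<lambda>s. W s \<omega>) ^ (2 * m) = (\<Sum>k<b^n. 1 / real b ^ n * \<bar>scaled_incr n k (\<lambda>s. W s \<omega>)\<bar> powr q) ^ (2 * m)"
          by (simp add: power_mean_def sum_divide_distrib)
        also have "\<dots> \<le> (\<Sum>k<b^n. 1 / real b ^ n) ^ (2 * m - 1) * (\<Sum>k<b^n. 1 / real b ^ n * (\<bar>scaled_incr n k (\<lambda>s. W s \<omega>)\<bar> powr q) ^ (2 * m))"
          using m bn by (intro even_power_sum_le) auto
        also have "(\<Sum>k<b^n. 1 / real b ^ n) = 1" using b by simp
        also have "1 ^ (2 * m - 1) * (\<Sum>k<b^n. 1 / real b ^ n * (\<bar>scaled_incr n k (\<lambda>s. W s \<omega>)\<bar> powr q) ^ (2 * m)) \<le> g \<omega>"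
        proof -
          have "(\<bar>x\<bar> powr q) ^ (2 * m) \<le> 1 + x ^ (2 * R)" for x
          proof -
            have "(\<bar>x\<bar> powr q) ^ (2 * m) = \<bar>x\<bar> powr (real (2 * m) * q)"
              using m by (cases "x = 0") (simp_all add: powr_power)
            also have "\<dots> \<le> 1 + x ^ (2 * R)"
              using R q by (intro powr_le_one_plus_even_power) (auto simp: algebra_simps)
            finally show ?thesis .
          qed
          then show ?thesis unfolding g_def power_one mult_1 using bn by (intro sum_mono mult_left_mono) auto
        qed
        finally show ?thesis .
      qed
      then show "AE \<omega> in M. 0 \<le> power_mean n (\<lambda>s. W s \<omega>) ^ (2 * m) \<and> power_mean n (\<lambda>s. W s \<omega>) ^ (2 * m) \<le> g \<omega>"
        by simp
    qed measurable
  qed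
  then show ?thesis by blast
qed

theorem limit_moments:
  assumes [measurable]: "V \<in> borel_measurable M"
    and lim: "AE \<omega> in M. (\<lambda>n. power_mean n (\<lambda>s. W s \<omega>)) \<longlonglongrightarrow> V \<omega>"
    and p: "0 \<le> p"
  shows "integrable M (\<lambda>\<omega>. \<bar>V \<omega>\<bar> powr p)"
proof -
  \<comment> \<open>\<open>Suc\<close> ensures \<open>1 \<le> m\<close> even for
    \<open>p = 0\<close>.\<close>
  define m where "m = Suc (nat \<lceil>p\<rceil>)"
  have m: "1 \<le> m" "p \<le> 2 * real m"
    using real_nat_ceiling_ge[of p] by (auto simp: m_def)
  obtain D where D: "\<And>n. integrable M (\<lambda>\<omega>. power_mean n (\<lambda>s. W s \<omega>) ^ (2 * m))"
    "\<And>n. (\<integral>\<omega>. power_mean n (\<lambda>s. W s \<omega>) ^ (2 * m) \<partial>M) \<le> D"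
    using power_mean_moment[OF m(1)] by blast
  have "(\<integral>\<^sup>+\<omega>. ennreal (V \<omega> ^ (2 * m)) \<partial>M) = (\<integral>\<^sup>+\<omega>. liminf (\<lambda>n. ennreal (power_mean n (\<lambda>s. W s \<omega>) ^ (2 * m))) \<partial>M)"
  proof (rule nn_integral_cong_AE)
    show "AE \<omega> in M. ennreal (V \<omega> ^ (2 * m)) = liminf (\<lambda>n. ennreal (power_mean n (\<lambda>s. W s \<omega>) ^ (2 * m)))"
      using lim
    proof eventually_elim
      case (elim \<omega>)
      then have "(\<lambda>n. ennreal (power_mean n (\<lambda>s. W s \<omega>) ^ (2 * m))) \<longlonglongrightarrow> ennreal (V \<omega> ^ (2 * m))"
        by (intro tendsto_ennrealI tendsto_power)
      then show ?case by (intro lim_imp_Liminf[symmetric]) auto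
    qed
  qed
  also have "\<dots> \<le> liminf (\<lambda>n. \<integral>\<^sup>+\<omega>. ennreal (power_mean n (\<lambda>s. W s \<omega>) ^ (2 * m)) \<partial>M)"
    by (intro nn_integral_liminf) measurable
  also have "\<dots> \<le> liminf (\<lambda>n. ennreal D)"
  proof (intro Liminf_mono always_eventually allI)
    fix n
    have "(\<integral>\<^sup>+\<omega>. ennreal (power_mean n (\<lambda>s. W s \<omega>) ^ (2 * m)) \<partial>M) = ennreal (\<integral>\<omega>. power_mean n (\<lambda>s. W s \<omega>) ^ (2 * m) \<partial>M)"
      by (intro nn_integral_eq_integral D) simp
    then show "(\<integral>\<^sup>+\<omega>. ennreal (power_mean n (\<lambda>s. W s \<omega>) ^ (2 * m)) \<partial>M) \<le> ennreal D"
      using D(2) by (simp add: ennreal_leI)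
  qed
  also have "\<dots> = ennreal D" by (simp add: Liminf_const)
  also have "\<dots> < \<infinity>" by simp
  finally have "integrable M (\<lambda>\<omega>. V \<omega> ^ (2 * m))"
    by (intro integrableI_nonneg) auto
  then have "integrable M (\<lambda>\<omega>. 1 + V \<omega> ^ (2 * m))" by simp
  then show ?thesis
  proof (rule Bochner_Integration.integrable_bound)
    show "AE \<omega> in M. norm (\<bar>V \<omega>\<bar> powr p) \<le> norm (1 + V \<omega> ^ (2 * m))"
      using powr_le_one_plus_even_power[OF p m(2)] by (simp add: order.trans[OF _ abs_ge_self])
  qed measurable
qed

end

section \<open>From the variation of the bridge to the means\<close>

theorem theorem2p1:
  fixes M :: "'a measure"
    and H \<tau> \<alpha> K :: real
    and b :: nat
    and \<kappa> :: "real \<Rightarrow> real"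
    and W :: "real \<Rightarrow> 'a \<Rightarrow> real"
    and V :: "'a \<Rightarrow> real"
  assumes "prob_space M"
    and "0 < H" and "H < 1"
    and "continuous_fBm M H W"
    and "\<kappa> \<in> {0..1} \<rightarrow> {0..1}" and "\<kappa> 0 = 0" and "\<kappa> 1 = 1"
    and "H < \<tau>" and "\<tau> \<le> 1" and "holder_continuous_on {0..1} \<tau> \<kappa>"
    and "0 < \<alpha>" and "\<alpha> < 1"
    and "2 \<le> b"
    and "K = roughness_exponent \<alpha> b"
    and "H > K"
    and "V \<in> borel_measurable M"
    and "AE \<omega> in M. \<forall>t\<in>{0..1}.
      (\<lambda>n. qth_variation b (1 / K) n (\<lambda>s. wiener_weierstrass_bridge \<alpha> b \<kappa> W s \<omega>) t)
        \<longlonglongrightarrow> V \<omega> * t"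
  shows "(\<forall>q::real. 1 \<le> q \<longrightarrow> integrable M (\<lambda>\<omega>. \<bar>V \<omega>\<bar> powr q)) \<and>
    absolutely_continuous lborel (distr M borel V) \<and>
    \<not> (\<exists>c. AE \<omega> in M. V \<omega> = c)"
proof -
  interpret prob_space M by fact
  \<comment> \<open>\<open>K < H < 1\<close> excludes the value 1 of the minimum, so \<alpha> is
    exactly \<open>b powr (- K)\<close>.\<close>
  have K: "K = - log (real b) \<alpha>" "K < 1"
    using assms(3,14,15) unfolding roughness_exponent_def by auto
  have b: "1 < real b" using \<open>2 \<le> b\<close> by simp
  have "log (real b) \<alpha> < 0" using b \<open>0 < \<alpha>\<close> \<open>\<alpha> < 1\<close> by simp
  then have K0: "0 < K" using K by simp
  have \<alpha>: "\<alpha> = real b powr (- K)" using K b \<open>0 < \<alpha>\<close> by simp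
  have rough: "real b powr (- H) < \<alpha>" unfolding \<alpha> using b \<open>H > K\<close> by (intro powr_less_mono) auto
  obtain C where C: "\<And>s t. s \<in> {0..1} \<Longrightarrow> t \<in> {0..1} \<Longrightarrow> \<bar>\<kappa> s - \<kappa> t\<bar> \<le> C * \<bar>s - t\<bar> powr \<tau>"
    using \<open>holder_continuous_on {0..1} \<tau> \<kappa>\<close> unfolding holder_continuous_on_def by blast
  \<comment> \<open>On the unit interval distances are at most 1, so passing from \<tau> to the
    smaller exponent \<open>H\<close> enlarges the bound; the absolute value keeps the constant
    nonnegative.\<close>
  have C': "\<bar>\<kappa> s - \<kappa> t\<bar> \<le> \<bar>C\<bar> * \<bar>s - t\<bar> powr H" if "s \<in> {0..1}" "t \<in> {0..1}" for s t
  proof -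
    have "\<bar>\<kappa> s - \<kappa> t\<bar> \<le> C * \<bar>s - t\<bar> powr \<tau>" by (rule C[OF that])
    also have "\<dots> \<le> \<bar>C\<bar> * \<bar>s - t\<bar> powr \<tau>" by (intro mult_right_mono) auto
    also have "\<dots> \<le> \<bar>C\<bar> * \<bar>s - t\<bar> powr H"
      using that \<open>H < \<tau>\<close> by (intro mult_left_mono powr_mono') auto
    finally show ?thesis .
  qed
  interpret weierstrass_fBm \<alpha> H "\<bar>C\<bar>" b \<kappa> M W "1 / K"
    by unfold_locales (use assms rough C' K K0 in auto)
  \<comment> \<open>This factor turns the sum over \<open>b ^ n\<close> cells into a mean.\<close>
  have scale: "(\<alpha> ^ n) powr (1 / K) = 1 / real b ^ n" for n
  proof -
    have "\<alpha> ^ n = real b powr (- (real n * K))" unfolding \<alpha> using b by (subst powr_power) auto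
    then have "(\<alpha> ^ n) powr (1 / K) = real b powr (- real n)" using K0 by (simp add: powr_powr)
    then show ?thesis using b by (simp add: powr_minus_divide powr_realpow)
  qed
  have variation: "qth_variation b (1 / K) n (\<lambda>s. wiener_weierstrass_bridge \<alpha> b \<kappa> W s \<omega>) 1
      = power_mean n (\<lambda>s. W s \<omega>)" for n \<omega>
  proof -
    have "fractional_bridge \<kappa> W u \<omega> = bridge (\<lambda>s. W s \<omega>) u" for u
      by (simp add: fractional_bridge_def bridge_def)
    note incr = weierstrass_increment[of W \<omega> "\<lambda>s. W s \<omega>", OF this]
    have "nat \<lfloor>1 * real b ^ n\<rfloor> = b ^ n" by (simp flip: of_nat_power)
    then show ?thesis
      unfolding qth_variation_def power_mean_def incr using \<open>0 < \<alpha>\<close>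
      by (simp add: abs_mult powr_mult scale sum_divide_distrib)
  qed
  have lim: "AE \<omega> in M. (\<lambda>n. power_mean n (\<lambda>s. W s \<omega>)) \<longlonglongrightarrow> V \<omega>"
    using assms(17)
  proof eventually_elim
    case (elim \<omega>)
    then show ?case using variation by (force dest: bspec[of _ _ 1])
  qed
  have moments: "integrable M (\<lambda>\<omega>. \<bar>V \<omega>\<bar> powr p)" if "1 \<le> p" for p
    using that by (intro limit_moments[OF assms(16) lim]) auto
  have ac: "absolutely_continuous lborel (distr M borel V)"
    by (rule limit_law_absolutely_continuous[OF assms(16) lim])
  have "\<not> (AE \<omega> in M. V \<omega> = c)" for c
  proof
    assume c: "AE \<omega> in M. V \<omega> = c"
    \<comment> \<open>An atom at \<open>c\<close> would give positive mass to a Lebesgue null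
      set.\<close>
    have "{c} \<in> null_sets lborel" by (auto simp: null_sets_def)
    then have "{c} \<in> null_sets (distr M borel V)" using ac unfolding absolutely_continuous_def by blast
    then have "AE x in distr M borel V. x \<notin> {c}" by (rule AE_not_in)
    then have "AE \<omega> in M. V \<omega> \<noteq> c"
      using assms(16) by (subst (asm) AE_distr_iff) auto
    with c have "AE \<omega> in M. False" by eventually_elim simp
    then show False by simp
  qed
  with moments ac show ?thesis by blast
qed

end
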